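(* Let $n,p$ be real numbers with $0<p<n/2$, let $W=W_{p,n}$, let $a\in\mathbb C\setminus\{0\}$, and let $$\tilde W(t)=e^{-t^2}e^{tM}e^{tM^*},\quad t\in\mathbb R,\qquad M=\begin{pmatrix}0&a\\0&0\end{pmatrix}.$$ Then the algebra $\mathcal D(W)$ is isomorphic to the algebra $\mathcal D(\tilde W)$.
   Context: Weight: for real $0<p<n/2$, $$W_{p,n}(x)=(1-x^2)^{\frac n2-1}\begin{pmatrix} p\,x^2+n-p & -nx\\ -nx & (n-p)x^2+p\end{pmatrix},\quad x\in[-1,1].$$ $M_2$ denotes complex $2\times2$ matrices, $T^*$ the conjugate transpose. For a weight $U$ of size $2$ on an interval $(c,d)$ (possibly infinite; here $U=W$ on $(-1,1)$ or $U=\tilde W$ on $\mathbb R$), on $M_2[x]$ use the matrix-valued form $(P,Q)=\int_c^d P(x)U(x)Q(x)^*\,dx$; $\{Q_w\}_{w\ge0}$ is the unique sequence of monic orthogonal polynomials ($Q_w\in M_2[x]$ monic of degree $w$, $(Q_w,Q_{w'})=0$ for $w\neq w'$). Differential operators $D=\sum_{i=0}^s\partial^iF_i$, $\partial=\frac{d}{dx}$, $F_i\in M_2[x]$, act on the right: $PD=\sum_i \partial^i(P)\,F_i$; the product satisfies $P(DE)=(PD)E$. $$\mathcal D(U)=\{D:\ Q_wD=\Lambda_w(D)Q_w \text{ for some }\Lambda_w(D)\in M_2,\ \text{for all } w\ge0\},$$ an associative unital algebra over $\mathbb C$. (The coefficients of any such $D$ are automatically polynomials with $\deg F_i\le i$.)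 Isomorphic means isomorphic as $\mathbb C$-algebras. *)

theory Defs
  imports
    "HOL-Analysis.Analysis"
    "HOL-Computational_Algebra.Polynomial"
    "HOL-Algebra.QuotRing"
    "HOL-Algebra.Module"
begin

text \<open>
  Caution: on the type \<open>'a^2^2\<close> the constants \<open>*\<close> and \<open>1\<close> are componentwise.
  The matrix product is \<open>**\<close> and the identity matrix is \<open>mat 1\<close>.
\<close>

section \<open>Matrices and matrix polynomials\<close>

type_synonym cmat = "complex^2^2"

type_synonym mpoly = "(complex poly)^2^2"

definition mscale :: "'a::times \<Rightarrow> 'a^2^2 \<Rightarrow> 'a^2^2" where
  "mscale c = map_matrix (\<lambda>z. c * z)"

definition mstar :: "cmat \<Rightarrow> cmat" where
  "mstar A = transpose (map_matrix cnj A)"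

definition mpow :: "cmat \<Rightarrow> nat \<Rightarrow> cmat" where
  "mpow A k = ((\<lambda>B. A ** B) ^^ k) (mat 1)"

definition mexp :: "cmat \<Rightarrow> cmat" where
  "mexp A = (\<Sum>k. mpow A k /\<^sub>R fact k)"

definition meval :: "mpoly \<Rightarrow> real \<Rightarrow> cmat" where
  "meval P x = map_matrix (\<lambda>p. poly p (of_real x)) P"

definition mconst :: "cmat \<Rightarrow> mpoly" where
  "mconst = map_matrix (\<lambda>c. [:c:])"

definition mcoeff :: "mpoly \<Rightarrow> nat \<Rightarrow> cmat" where
  "mcoeff P k = map_matrix (\<lambda>p. coeff p k) P"

definition mderiv :: "mpoly \<Rightarrow> mpoly" where
  "mderiv = map_matrix pderiv"

definition monic_of_degree :: "nat \<Rightarrow> mpoly \<Rightarrow> bool" where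
  "monic_of_degree w P \<longleftrightarrow> mcoeff P w = mat 1 \<and> (\<forall>k>w. mcoeff P k = 0)"

section \<open>Orthogonal polynomials\<close>

definition mform :: "real set \<Rightarrow> (real \<Rightarrow> cmat) \<Rightarrow> mpoly \<Rightarrow> mpoly \<Rightarrow> cmat" where
  "mform S U P Q = (LINT x:S|lborel. meval P x ** U x ** mstar (meval Q x))"

definition monic_orthogonal :: "real set \<Rightarrow> (real \<Rightarrow> cmat) \<Rightarrow> (nat \<Rightarrow> mpoly) \<Rightarrow> bool" where
  "monic_orthogonal S U Q \<longleftrightarrow>
     (\<forall>w. monic_of_degree w (Q w)) \<and> (\<forall>w w'. w \<noteq> w' \<longrightarrow> mform S U (Q w) (Q w') = 0)"

text \<open>If \<open>U\<close> is positive definite almost everywhere on the interval \<open>S\<close>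
  and has finite moments of all orders, this sequence exists and is unique.\<close>

definition mop :: "real set \<Rightarrow> (real \<Rightarrow> cmat) \<Rightarrow> nat \<Rightarrow> mpoly" where
  "mop S U = (THE Q. monic_orthogonal S U Q)"

section \<open>Differential operators acting on the right\<close>

text \<open>
  The operator \<open>\<Sum>i. \<partial>\<^sup>i F\<^sub>i\<close> is the polynomial in \<open>\<partial>\<close> with coefficients \<open>F\<^sub>i\<close>;
  only the additive structure of the type \<open>poly\<close> is used. The product comes from the Leibniz rule
  \<open>(\<partial>\<^sup>i F) (\<partial>\<^sup>j G) = \<Sum>k\<le>j. (j choose k) \<partial>\<^bsup>i+k\<^esup> F\<^bsup>(j-k)\<^esup> G\<close>;
  the theorem \<open>act_dmult\<close> below says that \<open>P(DE) = (PD)E\<close>, and by \<open>act_inject\<close> this determines it.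
\<close>

type_synonym diffop = "mpoly poly"

definition act :: "diffop \<Rightarrow> mpoly \<Rightarrow> mpoly" where
  "act D P = (\<Sum>i\<le>degree D. (mderiv ^^ i) P ** coeff D i)"

definition dmult :: "diffop \<Rightarrow> diffop \<Rightarrow> diffop" where
  "dmult D E = (\<Sum>i\<le>degree D. \<Sum>j\<le>degree E. \<Sum>k\<le>j.
     monom (mscale (of_nat (j choose k)) ((mderiv ^^ (j - k)) (coeff D i) ** coeff E j)) (i + k))"

definition dscale :: "complex \<Rightarrow> diffop \<Rightarrow> diffop" where
  "dscale c = map_poly (mscale [:c:])"

definition DO :: "real set \<Rightarrow> (real \<Rightarrow> cmat) \<Rightarrow> diffop set" where
  "DO S U = {D. \<forall>w. \<exists>L. act D (mop S U w) = mconst L ** mop S U w}"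

definition DO_algebra :: "real set \<Rightarrow> (real \<Rightarrow> cmat) \<Rightarrow> (complex, diffop) module" where
  "DO_algebra S U =
     \<lparr>carrier = DO S U, mult = dmult, one = [:mat 1:], zero = 0, add = (+), smult = dscale\<rparr>"

definition alg_iso :: "('k, 'a) module \<Rightarrow> ('k, 'b) module \<Rightarrow> ('a \<Rightarrow> 'b) set" where
  "alg_iso A B = {h \<in> ring_iso A B. \<forall>c. \<forall>x\<in>carrier A. h (c \<odot>\<^bsub>A\<^esub> x) = c \<odot>\<^bsub>B\<^esub> h x}"

section \<open>The two weights\<close>

definition W :: "real \<Rightarrow> real \<Rightarrow> real \<Rightarrow> cmat" where
  "W p n x = map_matrix of_real
     ((1 - x\<^sup>2) powr (n / 2 - 1) *\<^sub>R
        vector [vector [p * x\<^sup>2 + n - p, - n * x],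
                vector [- n * x, (n - p) * x\<^sup>2 + p]])"

definition W_tilde :: "complex \<Rightarrow> real \<Rightarrow> cmat" where
  "W_tilde a t = (let M = vector [vector [0, a], vector [0, 0]] in
     exp (- t\<^sup>2) *\<^sub>R (mexp (t *\<^sub>R M) ** mexp (t *\<^sub>R mstar M)))"

section \<open>The product of differential operators is composition\<close>

lemma act_bound: "degree D \<le> N \<Longrightarrow> act D P = (\<Sum>i\<le>N. (mderiv ^^ i) P ** coeff D i)"
  unfolding act_def by (rule sum.mono_neutral_left) (auto simp: coeff_eq_0)

lemma act_0 [simp]: "act 0 P = 0"
  by (simp add: act_def)

lemma act_add: "act (D + E) P = act D P + act E P"
proof -
  let ?N = "max (degree D) (degree E)"
  have "degree (D + E) \<le> ?N" by (rule degree_add_le_max)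
  then show ?thesis
    by (simp add: act_bound[where N = ?N] matrix_add_ldistrib sum.distrib)
qed

lemma act_sum: "act (sum f A) P = (\<Sum>a\<in>A. act (f a) P)"
  by (induction A rule: infinite_finite_induct) (simp_all add: act_add)

lemma act_monom: "act (monom F i) P = (mderiv ^^ i) P ** F"
  by (simp add: act_bound[OF degree_monom_le] if_distrib[of "\<lambda>x. _ ** x"] cong: if_cong)

lemma act_one: "act [:mat 1:] P = P"
  by (simp add: act_def)

lemma mderiv_add: "mderiv (A + B) = mderiv A + mderiv B"
  by (simp add: mderiv_def vec_eq_iff pderiv_add)

lemma mderiv_0 [simp]: "mderiv 0 = 0"
  by (simp add: mderiv_def vec_eq_iff)

lemma mderiv_pow_add: "(mderiv ^^ j) (A + B) = (mderiv ^^ j) A + (mderiv ^^ j) B"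
  by (induction j) (simp_all add: mderiv_add)

lemma mderiv_pow_0 [simp]: "(mderiv ^^ j) 0 = 0"
  by (induction j) simp_all

lemma mderiv_pow_sum: "(mderiv ^^ j) (sum f A) = (\<Sum>a\<in>A. (mderiv ^^ j) (f a))"
  by (induction A rule: infinite_finite_induct) (simp_all add: mderiv_pow_add)

lemma mderiv_pow_nth: "(mderiv ^^ j) A $ r $ s = (pderiv ^^ j) (A $ r $ s)"
  by (induction j) (simp_all add: mderiv_def)

lemma mderiv_mult: "mderiv (A ** B) = mderiv A ** B + A ** mderiv B"
  by (simp add: mderiv_def vec_eq_iff matrix_matrix_mult_def pderiv_add pderiv_mult sum_2)

lemma mderiv_scale: "mderiv (mscale (of_nat c) A) = mscale (of_nat c) (mderiv A)"
  by (simp add: mderiv_def mscale_def vec_eq_iff pderiv_mult)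

lemma mscale_mult_right: "A ** mscale (c::complex poly) B = mscale c (A ** B)"
  by (simp add: mscale_def vec_eq_iff matrix_matrix_mult_def sum_2 algebra_simps)

lemma mscale_mult_left: "mscale (c::complex poly) A ** B = mscale c (A ** B)"
  by (simp add: mscale_def vec_eq_iff matrix_matrix_mult_def sum_2 algebra_simps)

lemma leibniz:
  "(mderiv ^^ j) (A ** B) =
     (\<Sum>k\<le>j. mscale (of_nat (j choose k)) ((mderiv ^^ k) A ** (mderiv ^^ (j - k)) B))"
proof (induction j)
  case 0
  show ?case by (simp add: mscale_def vec_eq_iff)
next
  case (Suc j)
  let ?a = "\<lambda>k. (mderiv ^^ k) A" and ?b = "\<lambda>k. (mderiv ^^ k) B"
  let ?t = "\<lambda>c k. mscale (of_nat c) (?a k ** ?b (Suc j - k))"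
  have scale_add: "mscale (of_nat (m + n)) X = mscale (of_nat m) X + mscale (of_nat n) (X::mpoly)"
    for m n X by (simp add: mscale_def vec_eq_iff algebra_simps)
  have scale_add': "mscale (of_nat m) (X + Y) = mscale (of_nat m) X + mscale (of_nat m) (Y::mpoly)"
    for m X Y by (simp add: mscale_def vec_eq_iff algebra_simps)
  have scale_0: "mscale 0 X = (0::mpoly)" for X by (simp add: mscale_def vec_eq_iff)
  have "(mderiv ^^ Suc j) (A ** B) =
      (\<Sum>k\<le>j. mscale (of_nat (j choose k)) (mderiv (?a k ** ?b (j - k))))"
    using mderiv_pow_sum[of 1 _ "{..j}"] by (simp add: Suc.IH mderiv_scale)
  also have "\<dots> = (\<Sum>k\<le>j. ?t (j choose k) (Suc k)) + (\<Sum>k\<le>j. ?t (j choose k) k)"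
    by (simp add: mderiv_mult scale_add' sum.distrib Suc_diff_le)
  also have "(\<Sum>k\<le>j. ?t (j choose k) k) = (\<Sum>k\<le>Suc j. ?t (j choose k) k)"
    using scale_0 by (simp add: binomial_eq_0)
  also have "\<dots> = ?t 1 0 + (\<Sum>k\<le>j. ?t (j choose Suc k) (Suc k))"
    by (subst sum.atMost_Suc_shift) simp
  also have "(\<Sum>k\<le>j. ?t (j choose k) (Suc k)) + \<dots> =
      ?t 1 0 + (\<Sum>k\<le>j. ?t (Suc j choose Suc k) (Suc k))"
    by (simp only: binomial_Suc_Suc scale_add sum.distrib ac_simps)
  also have "\<dots> = (\<Sum>k\<le>Suc j. ?t (Suc j choose k) k)"
    by (subst sum.atMost_Suc_shift) simp
  finally show ?case .
qed

lemma matrix_add_rdistrib_mpoly: "(A + B) ** C = A ** C + B ** (C::mpoly)"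
  by (simp add: vec_eq_iff matrix_matrix_mult_def algebra_simps sum.distrib)

lemma matrix_mult_sum_left: "sum f I ** (B::mpoly) = (\<Sum>i\<in>I. f i ** B)"
  by (induction I rule: infinite_finite_induct) (simp_all add: matrix_add_rdistrib_mpoly)

theorem act_dmult: "act (dmult D E) P = act E (act D P)"
proof -
  have "act (dmult D E) P = (\<Sum>i\<le>degree D. \<Sum>j\<le>degree E. \<Sum>k\<le>j.
      mscale (of_nat (j choose k))
        ((mderiv ^^ (i + k)) P ** (mderiv ^^ (j - k)) (coeff D i) ** coeff E j))"
    by (simp add: dmult_def act_sum act_monom mscale_mult_right matrix_mul_assoc)
  also have "\<dots> = (\<Sum>i\<le>degree D. \<Sum>j\<le>degree E.
      (mderiv ^^ j) ((mderiv ^^ i) P ** coeff D i) ** coeff E j)"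
    by (simp add: leibniz matrix_mult_sum_left mscale_mult_left funpow_add[symmetric]
        flip: comp_apply[of "mderiv ^^ _" "mderiv ^^ _"] add: add.commute)
  also have "\<dots> = act E (act D P)"
    unfolding act_def mderiv_pow_sum matrix_mult_sum_left by (rule sum.swap)
  finally show ?thesis .
qed

theorem act_inject:
  assumes "\<And>P. act D P = act E P"
  shows "D = E"
proof -
  have *: "D = 0" if D: "\<And>P. act D P = 0" for D
  proof -
    have "coeff D m = 0" for m
    proof (induction m rule: less_induct)
      case (less m)
      let ?P = "map_matrix (\<lambda>z. monom z m) (mat 1) :: mpoly"
      let ?N = "max m (degree D)"
      have poch: "pochhammer 1 m = (fact m :: complex)"
        by (simp add: pochhammer_fact)
      have hi: "(mderiv ^^ i) ?P = 0" if "m < i" for i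
        using that
        by (auto simp: vec_eq_iff mderiv_pow_nth poly_eq_iff coeff_higher_pderiv)
      have "act D ?P = (\<Sum>i\<le>?N. (mderiv ^^ i) ?P ** coeff D i)"
        by (rule act_bound) simp
      also have "\<dots> = (\<Sum>i\<in>{m}. (mderiv ^^ i) ?P ** coeff D i)"
      proof (rule sum.mono_neutral_right)
        show "\<forall>i\<in>{..?N} - {m}. (mderiv ^^ i) ?P ** coeff D i = 0"
          using hi less.IH by (auto simp: matrix_matrix_mult_def vec_eq_iff neq_iff)
      qed auto
      also have "\<dots> = (mderiv ^^ m) ?P ** coeff D m"
        by simp
      also have "(mderiv ^^ m) ?P = mscale (of_nat (fact m)) (mat 1)"
        by (auto simp: vec_eq_iff mderiv_pow_nth poly_eq_iff coeff_higher_pderiv mscale_def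
            mat_def poch of_nat_poly coeff_pCons split: nat.splits)
      finally have "mscale (of_nat (fact m)) (coeff D m) = 0"
        using D by (simp add: mscale_mult_left)
      then show ?case
        by (simp add: mscale_def vec_eq_iff)
    qed
    then show "D = 0" by (simp add: poly_eq_iff)
  qed
  have "act (D - E) P = 0" for P
    using act_add[of "D - E" E P] assms[of P] by simp
  with * show ?thesis by fastforce
qed

lemma mderiv_mconst: "(mderiv ^^ i) (mconst L ** P) = mconst L ** (mderiv ^^ i) P"
proof -
  have "mderiv (mconst L) = 0"
    by (simp add: mderiv_def mconst_def vec_eq_iff pderiv_pCons)
  moreover have "0 ** A = 0" for A :: mpoly
    by (simp add: vec_eq_iff matrix_matrix_mult_def)
  ultimately show ?thesis
    by (induction i) (simp_all add: mderiv_mult)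
qed

lemma act_mconst: "act D (mconst L ** P) = mconst L ** act D P"
proof -
  have "A ** sum f I = (\<Sum>i\<in>I. A ** (f i :: mpoly))" for A :: mpoly and f and I :: "nat set"
    by (induction I rule: infinite_finite_induct) (simp_all add: matrix_add_ldistrib)
  then show ?thesis
    by (simp add: act_def mderiv_mconst matrix_mul_assoc)
qed

lemma act_add_right: "act D (P + Q) = act D P + act D Q"
  by (simp add: act_def mderiv_pow_add matrix_add_rdistrib_mpoly sum.distrib)

lemma act_dscale: "act (dscale c D) P = mscale [:c:] (act D P)"
proof -
  have zero: "mscale [:c:] 0 = (0::mpoly)"
    by (simp add: mscale_def vec_eq_iff)
  moreover have "degree (dscale c D) \<le> degree D"
    by (rule degree_le) (simp add: dscale_def coeff_map_poly zero coeff_eq_0)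
  moreover have "mscale [:c:] (sum f I) = (\<Sum>i\<in>I. mscale [:c:] (f i :: mpoly))"
    for f and I :: "nat set"
    by (simp add: mscale_def vec_eq_iff sum_distrib_left[of "[:c:]", simplified])
  ultimately show ?thesis
    by (simp add: act_bound[where N = "degree D"] dscale_def coeff_map_poly mscale_mult_right)
qed

theorem ring_DO_algebra: "ring (DO_algebra S U)"
proof -
  let ?Q = "mop S U"
  have DO_I: "D \<in> DO S U" if "\<And>w. act D (?Q w) = mconst (L w) ** ?Q w" for D L
    using that unfolding DO_def by blast
  have DO_E: "\<exists>L. \<forall>w. act D (?Q w) = mconst (L w) ** ?Q w" if "D \<in> DO S U" for D
    using that unfolding DO_def by (auto intro: choice)
  have mult: "dmult D E \<in> DO S U" if "D \<in> DO S U" "E \<in> DO S U" for D E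
  proof -
    from that obtain L M where "\<And>w. act D (?Q w) = mconst (L w) ** ?Q w"
      "\<And>w. act E (?Q w) = mconst (M w) ** ?Q w" using DO_E by metis
    moreover have "mconst A ** mconst B = mconst (A ** B)" for A B
      by (simp add: mconst_def vec_eq_iff matrix_matrix_mult_def sum_2 mult.commute)
    ultimately show ?thesis
      by (intro DO_I[where L = "\<lambda>w. L w ** M w"])
         (simp add: act_dmult act_mconst matrix_mul_assoc)
  qed
  have add: "D + E \<in> DO S U" if "D \<in> DO S U" "E \<in> DO S U" for D E
  proof -
    from that obtain L M where "\<And>w. act D (?Q w) = mconst (L w) ** ?Q w"
      "\<And>w. act E (?Q w) = mconst (M w) ** ?Q w" using DO_E by metis
    moreover have "mconst (A + B) = mconst A + mconst B" for A B
      by (simp add: mconst_def vec_eq_iff)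
    ultimately show ?thesis
      by (intro DO_I[where L = "\<lambda>w. L w + M w"])
         (simp add: act_add matrix_add_rdistrib_mpoly)
  qed
  have scale: "dscale c D \<in> DO S U" if "D \<in> DO S U" for c D
  proof -
    from that obtain L where "\<And>w. act D (?Q w) = mconst (L w) ** ?Q w"
      using DO_E by metis
    moreover have "mconst (mscale c A) = mscale [:c:] (mconst A)" for A
      by (simp add: mconst_def mscale_def vec_eq_iff)
    ultimately show ?thesis
      by (intro DO_I[where L = "\<lambda>w. mscale c (L w)"])
         (simp add: act_dscale mscale_mult_left)
  qed
  have zero: "0 \<in> DO S U"
    by (rule DO_I[where L = "\<lambda>w. 0"]) (simp add: mconst_def vec_eq_iff matrix_matrix_mult_def)
  have "mconst (mat 1) = mat 1"
    by (simp add: mconst_def vec_eq_iff mat_def one_pCons)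
  then have one: "[:mat 1:] \<in> DO S U"
    by (intro DO_I[where L = "\<lambda>w. mat 1"]) (simp add: act_one)
  have neg: "\<exists>E\<in>DO S U. E + D = 0" if "D \<in> DO S U" for D
  proof (rule bexI)
    show "dscale (- 1) D + D = 0"
      by (rule act_inject) (simp add: act_add act_dscale mscale_def vec_eq_iff)
  qed (rule scale[OF that])
  show ?thesis
  proof (rule ringI)
    show "abelian_group (DO_algebra S U)"
      by (rule abelian_groupI) (use neg in \<open>auto simp: DO_algebra_def add zero ac_simps add.commute\<close>)
    show "monoid (DO_algebra S U)"
      by (rule monoidI)
         (auto simp: DO_algebra_def mult one act_dmult act_one intro: act_inject)
  qed (auto simp: DO_algebra_def act_dmult act_add act_add_right intro: act_inject)
qed

end

theory Submission
  imports Defs "HOL-Probability.Distributions"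
begin

text \<open>
  For both weights the rows of the orthogonal polynomials arise from one family \<open>G w\<close> of classical
  scalar polynomials (Gegenbauer or Hermite) by two first order operators, as in a Darboux transformation:
  for the Gegenbauer weight they are multiples of \<open>(p G + x G', G')\<close> and
  \<open>(G', (n - p) G + x G')\<close>. Composing with the operators that lead back to \<open>G w\<close> gives second order
  operators in the algebra whose eigenvalues are \<open>diag (x\<^sub>w, x\<^sub>w - 1) C\<close>, where \<open>x\<^sub>w\<close> is an affine function
  of the eigenvalue of \<open>G w\<close> and \<open>C\<close> is any constant matrix. They generate
  \<open>\<complex> + diag (x, x - 1) M\<^sub>2(\<complex>[x])\<close>, which depends neither on the weight nor on its parameters.

  There are no further operators. Multiplying by the known ones, one is reduced to operators with eigenvalue
  \<open>e\<^sub>w E\<^sub>1\<^sub>1\<close> or \<open>e\<^sub>w E\<^sub>2\<^sub>2\<close>. Here \<open>e\<^sub>w\<close> is a polynomial in \<open>x\<^sub>w\<close>: in the Hermite case by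
  comparing leading coefficients, in the Gegenbauer case by evaluating at the end point 1, where the
  differential equation expresses all derivatives of \<open>G w\<close> through its value there. A nonzero constant
  \<open>e\<^sub>w\<close> is impossible, since the subleading coefficients of the orthogonal polynomials are not
  polynomial in \<open>w\<close>.
\<close>

section \<open>Two by two matrices\<close>

definition mat2 :: "'a::zero \<Rightarrow> 'a \<Rightarrow> 'a \<Rightarrow> 'a \<Rightarrow> 'a^2^2" where
  "mat2 a b c d = vector [vector [a, b], vector [c, d]]"

lemma mat2_nth [simp]:
  "mat2 a b c d $ 1 $ 1 = a" "mat2 a b c d $ 1 $ 2 = b"
  "mat2 a b c d $ 2 $ 1 = c" "mat2 a b c d $ 2 $ 2 = d"
  by (simp_all add: mat2_def)

lemma mat_eq_iff_2:
  "A = B \<longleftrightarrow> A $ 1 $ 1 = B $ 1 $ 1 \<and> A $ 1 $ 2 = B $ 1 $ 2 \<and> A $ 2 $ 1 = B $ 2 $ 1 \<and> A $ 2 $ 2 = B $ 2 $ 2"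
  for A B :: "'a^2^2"
  by (auto simp: vec_eq_iff forall_2)

lemma mat2_eta: "mat2 (A $ 1 $ 1) (A $ 1 $ 2) (A $ 2 $ 1) (A $ 2 $ 2) = A"
  by (simp add: mat_eq_iff_2)

lemma matrix_mult_nth_2: "(A ** B) $ i $ j = A $ i $ 1 * B $ 1 $ j + A $ i $ 2 * B $ 2 $ j"
  for A :: "'a::semiring_1^2^2"
  by (simp add: matrix_matrix_mult_def sum_2)

lemma mat2_mult: "mat2 a b c d ** mat2 a' b' c' d' =
    mat2 (a * a' + b * c') (a * b' + b * d') (c * a' + d * c') (c * b' + d * d')"
  for a :: "'a::semiring_1"
  by (simp add: mat_eq_iff_2 matrix_mult_nth_2)

lemma mat2_add: "mat2 a b c d + mat2 a' b' c' d' = mat2 (a + a') (b + b') (c + c') (d + d')"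
  for a :: "'a::monoid_add"
  by (simp add: mat_eq_iff_2)

lemma mscale_mat2: "mscale e (mat2 a b c d) = mat2 (e * a) (e * b) (e * c) (e * d)"
  for a :: "'a::mult_zero"
  by (simp add: mat_eq_iff_2 mscale_def)

lemma mat_1_eq_mat2: "mat 1 = mat2 1 0 0 1"
  by (simp add: mat_eq_iff_2 mat_def)

lemma zero_eq_mat2: "(0 :: 'a::zero^2^2) = mat2 0 0 0 0"
  by (simp add: mat_eq_iff_2)

lemma mconst_mat2: "mconst (mat2 a b c d) = mat2 [:a:] [:b:] [:c:] [:d:]"
  by (simp add: mat_eq_iff_2 mconst_def)

lemmas mat2_simps = mat2_mult mat2_add mscale_mat2 mat_1_eq_mat2 zero_eq_mat2

lemma mconst_nth: "mconst A $ i $ j = [:A $ i $ j:]"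
  by (simp add: mconst_def)

lemma mconst_mult: "mconst (A ** B) = mconst A ** mconst B"
  by (simp add: mat_eq_iff_2 mconst_def matrix_mult_nth_2 mult.commute)

lemma mconst_add: "mconst (A + B) = mconst A + mconst B"
  by (simp add: mat_eq_iff_2 mconst_def)

lemma mconst_mscale: "mconst (mscale c A) = mscale [:c:] (mconst A)"
  by (simp add: mat_eq_iff_2 mconst_def mscale_def)

lemma mconst_1: "mconst (mat 1) = mat 1"
  by (simp add: mat_eq_iff_2 mconst_def mat_def one_pCons)

lemma mconst_0: "mconst 0 = 0"
  by (simp add: zero_eq_mat2 mconst_mat2)

lemma matrix_mult_minus_left: "(A - B) ** C = A ** C - B ** C" for A B C :: "'a::ring_1^2^2"
  by (simp add: mat_eq_iff_2 matrix_mult_nth_2 left_diff_distrib)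

lemma matrix_mult_0_left: "(0 :: 'a^2^2) ** C = 0" for C :: "('a::ring_1)^2^2"
  by (simp add: mat_eq_iff_2 matrix_mult_nth_2)

section \<open>The common model of the two algebras\<close>

definition mpeval :: "mpoly \<Rightarrow> complex \<Rightarrow> cmat" where
  "mpeval M z = map_matrix (\<lambda>f. poly f z) M"

lemma mpeval_mat2: "mpeval (mat2 a b c d) z = mat2 (poly a z) (poly b z) (poly c z) (poly d z)"
  by (simp add: mat_eq_iff_2 mpeval_def)

lemma mpeval_mult: "mpeval (A ** B) z = mpeval A z ** mpeval B z"
  by (simp add: mat_eq_iff_2 mpeval_def matrix_mult_nth_2)

lemma mpeval_add: "mpeval (A + B) z = mpeval A z + mpeval B z"
  by (simp add: mat_eq_iff_2 mpeval_def)

lemma mpeval_mscale: "mpeval (mscale [:c:] A) z = mscale c (mpeval A z)"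
  by (simp add: mat_eq_iff_2 mpeval_def mscale_def)

lemma mpeval_1: "mpeval (mat 1) z = mat 1"
  by (simp add: mat_1_eq_mat2 mpeval_mat2)

lemma poly_eq_if_eq_on_infinite:
  fixes f g :: "complex poly" and x :: "nat \<Rightarrow> complex"
  assumes "inj x" and "\<And>w. poly f (x w) = poly g (x w)"
  shows "f = g"
proof (rule ccontr)
  assume "f \<noteq> g"
  then have "finite {z. poly (f - g) z = 0}"
    by (intro poly_roots_finite) simp
  moreover have "range x \<subseteq> {z. poly (f - g) z = 0}"
    using assms(2) by auto
  ultimately show False
    using assms(1) finite_subset range_inj_infinite by blast
qed

lemma mpeval_inject:
  assumes "inj x" and "\<And>w :: nat. mpeval A (x w) = mpeval B (x w)"
  shows "A = B"
  using assms poly_eq_if_eq_on_infinite[OF assms(1)]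
  by (simp add: mat_eq_iff_2 mpeval_def)

text \<open>Equivalently: matrix polynomials whose first row at 0 is \<open>(c, 0)\<close> and whose
  second row at 1 is \<open>(0, c)\<close>, with one common scalar \<open>c\<close>.\<close>

definition model :: "mpoly set" where
  "model = {mscale [:c:] (mat 1) + mat2 [:0, 1:] 0 0 [:-1, 1:] ** N |c N. True}"

lemma poly_split_at: "\<exists>q. f = [:poly f a:] + [:-a, 1:] * q" for f :: "complex poly"
proof -
  have "[:-a, 1:] dvd f - [:poly f a:]"
    by (simp add: poly_eq_0_iff_dvd[symmetric])
  then obtain q where "f - [:poly f a:] = [:-a, 1:] * q"
    by (elim dvdE)
  then show ?thesis
    by (intro exI[of _ q]) (simp add: algebra_simps)
qed

text \<open>Separates the algebra from the analysis. \<open>T\<close> stands for the eigenvalue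
  sequences of the operators, \<open>T_gen\<close> for the known second order operators, and
  \<open>T_11\<close>, \<open>T_22\<close>, \<open>T_const\<close> are the bounds from above that
  exclude any others.\<close>

locale eigenvalue_algebra =
  fixes T :: "(nat \<Rightarrow> cmat) set" and x :: "nat \<Rightarrow> complex"
  assumes T_add: "L \<in> T \<Longrightarrow> M \<in> T \<Longrightarrow> (\<lambda>w. L w + M w) \<in> T"
    and T_mult: "L \<in> T \<Longrightarrow> M \<in> T \<Longrightarrow> (\<lambda>w. L w ** M w) \<in> T"
    and T_one: "(\<lambda>w. mat 1) \<in> T"
    and T_scale: "L \<in> T \<Longrightarrow> (\<lambda>w. mscale c (L w)) \<in> T"
    and T_gen: "(\<lambda>w. mat2 (x w) 0 0 (x w - 1) ** C) \<in> T"
    and inj_x: "inj x" and x_neq: "x w \<noteq> 0" "x w \<noteq> 1"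
    and T_11: "(\<lambda>w. mat2 (e w) 0 0 0) \<in> T \<Longrightarrow> \<exists>R. \<forall>w. e w = poly R (x w)"
    and T_22: "(\<lambda>w. mat2 0 0 0 (e w)) \<in> T \<Longrightarrow> \<exists>R. \<forall>w. e w = poly R (x w)"
    and T_const: "(\<lambda>w. mat2 c 0 0 0) \<in> T \<Longrightarrow> c = 0"
begin

lemma T_cong: "L \<in> T \<Longrightarrow> (\<And>w. M w = L w) \<Longrightarrow> M \<in> T"
  by (metis ext)

lemma T_lin:
  assumes "L \<in> T" "M \<in> T" "\<And>w. K w = mscale c (L w) + mscale d (M w)"
  shows "K \<in> T"
  using T_cong[OF T_add[OF T_scale[OF assms(1)] T_scale[OF assms(2)]]] assms(3) by simp

lemma T_gen2: "(\<lambda>w. mat2 (x w * a) (x w * b) ((x w - 1) * c) ((x w - 1) * d)) \<in> T"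
  by (rule T_cong[OF T_gen[of "mat2 a b c d"]]) (simp add: mat2_simps)

text \<open>The entries of \<open>diag (x, x - 1)\<close> differ by 1, so the commutator with it
  kills the diagonal and reproduces the off-diagonal entries with opposite signs and no extra
  factor. Applied twice it therefore separates the two off-diagonal entries.\<close>

lemma T_commutator:
  assumes "(\<lambda>w. mat2 (a w) (b w) (c w) (d w)) \<in> T"
  shows "(\<lambda>w. mat2 0 (b w) (- c w) 0) \<in> T"
proof -
  let ?L = "\<lambda>w. mat2 (a w) (b w) (c w) (d w)" and ?X = "\<lambda>w. mat2 (x w) 0 0 (x w - 1)"
  have X: "?X \<in> T"
    using T_gen2[of 1 0 0 1] by simp
  show ?thesis
    by (rule T_lin[OF T_mult[OF X assms] T_mult[OF assms X], where c = 1 and d = "-1"])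
       (simp add: mat2_simps algebra_simps)
qed

text \<open>Horner's scheme: left multiplication by the generator raises the degree by one. It
  multiplies the second row by \<open>x w - 1\<close>, which is why the argument is shifted
  there.\<close>

lemma poly_in_T:
  fixes R :: "complex poly"
  shows "(\<lambda>w. mat2 (x w * poly R (x w)) 0 0 0) \<in> T"
    and "(\<lambda>w. mat2 0 (x w * poly R (x w)) 0 0) \<in> T"
    and "(\<lambda>w. mat2 0 0 ((x w - 1) * poly R (x w - 1)) 0) \<in> T"
    and "(\<lambda>w. mat2 0 0 0 ((x w - 1) * poly R (x w - 1))) \<in> T"
proof -
  note X = T_gen2[of 1 0 0 1]
  show "(\<lambda>w. mat2 (x w * poly R (x w)) 0 0 0) \<in> T"
  proof (induction R)
    case (pCons c R)
    show ?case
      by (rule T_lin[OF T_gen2[of c 0 0 0] T_mult[OF X pCons.IH], where c = 1 and d = 1])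
         (simp add: mat2_simps algebra_simps)
  qed (use T_gen2[of 0 0 0 0] in simp)
  show "(\<lambda>w. mat2 0 (x w * poly R (x w)) 0 0) \<in> T"
  proof (induction R)
    case (pCons c R)
    show ?case
      by (rule T_lin[OF T_gen2[of 0 c 0 0] T_mult[OF X pCons.IH], where c = 1 and d = 1])
         (simp add: mat2_simps algebra_simps)
  qed (use T_gen2[of 0 0 0 0] in simp)
  show "(\<lambda>w. mat2 0 0 ((x w - 1) * poly R (x w - 1)) 0) \<in> T"
  proof (induction R)
    case (pCons c R)
    show ?case
      by (rule T_lin[OF T_gen2[of 0 0 c 0] T_mult[OF X pCons.IH], where c = 1 and d = 1])
         (simp add: mat2_simps algebra_simps)
  qed (use T_gen2[of 0 0 0 0] in simp)
  show "(\<lambda>w. mat2 0 0 0 ((x w - 1) * poly R (x w - 1))) \<in> T"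
  proof (induction R)
    case (pCons c R)
    show ?case
      by (rule T_lin[OF T_gen2[of 0 0 0 c] T_mult[OF X pCons.IH], where c = 1 and d = 1])
         (simp add: mat2_simps algebra_simps)
  qed (use T_gen2[of 0 0 0 0] in simp)
qed

lemma model_in_T:
  assumes "M \<in> model"
  shows "(\<lambda>w. mpeval M (x w)) \<in> T"
proof -
  obtain c N where M: "M = mscale [:c:] (mat 1) + mat2 [:0, 1:] 0 0 [:-1, 1:] ** N"
    using assms by (auto simp: model_def)
  have shift: "poly (pcompose f [:1, 1:]) (x w - 1) = poly f (x w)" for f w
    by (simp add: poly_pcompose)
  let ?sum = "\<lambda>K L w. mscale 1 (K w :: cmat) + mscale 1 (L w)"
  have sum: "?sum K L \<in> T" if "K \<in> T" "L \<in> T" for K L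
    by (rule T_lin[OF that]) simp
  note ps = poly_in_T(1)[of "N $ 1 $ 1"] poly_in_T(2)[of "N $ 1 $ 2"]
    poly_in_T(3)[of "pcompose (N $ 2 $ 1) [:1, 1:]"] poly_in_T(4)[of "pcompose (N $ 2 $ 2) [:1, 1:]"]
  show ?thesis
    unfolding M
    by (rule T_cong[OF sum[OF sum[OF sum[OF ps(1,2)] sum[OF ps(3,4)]] T_scale[OF T_one, of c]]],
        subst mat2_eta[of N, symmetric])
       (simp add: mpeval_add mpeval_mult mpeval_mat2 mat2_simps shift algebra_simps)
qed

text \<open>Subtracting the part divisible by \<open>x\<close>, which lies in \<open>T\<close>,
  leaves a constant in the corner, and \<open>T_const\<close> forces it to be 0.\<close>

lemma T_11_vanish:
  assumes "(\<lambda>w. mat2 (e w) 0 0 0) \<in> T"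
  shows "\<exists>R. \<forall>w. e w = x w * poly R (x w)"
proof -
  obtain Q where Q: "\<And>w. e w = poly Q (x w)"
    using T_11[OF assms] by blast
  obtain R where R: "Q = [:poly Q 0:] + [:-0, 1:] * R"
    using poly_split_at by blast
  have eq: "e w = poly Q 0 + x w * poly R (x w)" for w
    unfolding Q by (subst R) simp
  have "(\<lambda>w. mat2 (poly Q 0) 0 0 0) \<in> T"
    by (rule T_lin[OF assms poly_in_T(1)[of R], where c = 1 and d = "-1"])
       (simp add: mat2_simps eq)
  from T_const[OF this] show ?thesis
    using eq by auto
qed

lemma T_22_vanish:
  assumes "(\<lambda>w. mat2 0 0 0 (e w)) \<in> T"
  shows "\<exists>R. \<forall>w. e w = (x w - 1) * poly R (x w)"
proof -
  obtain Q where Q: "\<And>w. e w = poly Q (x w)"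
    using T_22[OF assms] by blast
  obtain R where R: "Q = [:poly Q 1:] + [:-1, 1:] * R"
    using poly_split_at by blast
  have eq: "e w = poly Q 1 + (x w - 1) * poly R (x w)" for w
    unfolding Q by (subst R) (simp add: algebra_simps)
  have shift: "poly (pcompose R [:1, 1:]) (x w - 1) = poly R (x w)" for w
    by (simp add: poly_pcompose)
  have "(\<lambda>w. mat2 0 0 0 (poly Q 1)) \<in> T"
    by (rule T_lin[OF assms poly_in_T(4)[of "pcompose R [:1, 1:]"], where c = 1 and d = "-1"])
       (simp add: mat2_simps eq shift)
  \<comment> \<open>The difference to a multiple of the identity moves the constant to the upper
    corner, where \<open>T_const\<close> applies.\<close>
  then have "(\<lambda>w. mat2 (poly Q 1) 0 0 0) \<in> T"
    by (rule T_lin[OF T_one, where c = "poly Q 1" and d = "-1"]) (simp add: mat2_simps)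
  from T_const[OF this] show ?thesis
    using eq by auto
qed

lemma T_in_model:
  assumes "L \<in> T"
  shows "\<exists>M\<in>model. \<forall>w. L w = mpeval M (x w)"
proof -
  define a b c d where "a w = L w $ 1 $ 1" and "b w = L w $ 1 $ 2"
    and "c w = L w $ 2 $ 1" and "d w = L w $ 2 $ 2" for w
  have L: "L w = mat2 (a w) (b w) (c w) (d w)" for w
    unfolding a_def b_def c_def d_def by (simp add: mat2_eta)
  have L0: "(\<lambda>w. mat2 (a w) (b w) (c w) (d w)) \<in> T"
    by (rule T_cong[OF assms]) (simp add: L)
  note K = T_commutator[OF L0]
  note K2 = T_commutator[OF K]
  have b: "(\<lambda>w. mat2 0 (b w) 0 0) \<in> T"
    by (rule T_lin[OF K K2, where c = "1/2" and d = "1/2"]) (simp add: mat2_simps)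
  have c: "(\<lambda>w. mat2 0 0 (c w) 0) \<in> T"
    by (rule T_lin[OF K K2, where c = "-1/2" and d = "1/2"]) (simp add: mat2_simps)
  have ad: "(\<lambda>w. mat2 (a w) 0 0 (d w)) \<in> T"
    by (rule T_lin[OF L0 K2, where c = 1 and d = "-1"]) (simp add: mat2_simps)
  \<comment> \<open>The four matrix units, the first row scaled by \<open>x\<close> and the second
    by \<open>x - 1\<close>. Products with them carry any entry of \<open>L\<close> alone into a
    diagonal corner, where the two preceding lemmas apply.\<close>
  note e = T_gen2[of 1 0 0 0] T_gen2[of 0 1 0 0] T_gen2[of 0 0 1 0] T_gen2[of 0 0 0 1]
  have "(\<lambda>w. mat2 (a w * x w) 0 0 0) \<in> T"
    by (rule T_cong[OF T_mult[OF ad e(1)]]) (simp add: mat2_simps)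
  from T_11_vanish[OF this] obtain A where "\<And>w. a w * x w = x w * poly A (x w)"
    by blast
  then have A: "a w = poly A (x w)" for w
    using x_neq(1)[of w] by (metis mult.commute mult_left_cancel)
  have "(\<lambda>w. mat2 0 0 0 (d w * (x w - 1))) \<in> T"
    by (rule T_cong[OF T_mult[OF ad e(4)]]) (simp add: mat2_simps)
  from T_22_vanish[OF this] obtain D where "\<And>w. d w * (x w - 1) = (x w - 1) * poly D (x w)"
    by blast
  then have D: "d w = poly D (x w)" for w
    using x_neq(2)[of w] by (metis mult.commute mult_left_cancel right_minus_eq)
  obtain A' where A': "A = [:poly A 0:] + [:-0, 1:] * A'"
    using poly_split_at by blast
  obtain D' where D': "D = [:poly D 1:] + [:-1, 1:] * D'"
    using poly_split_at by blast
  have a_eq: "a w = poly A 0 + x w * poly A' (x w)" for w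
    unfolding A by (subst A') simp
  have d_eq: "d w = poly D 1 + (x w - 1) * poly D' (x w)" for w
    unfolding D by (subst D') (simp add: algebra_simps)
  have shift: "poly (pcompose D' [:1, 1:]) (x w - 1) = poly D' (x w)" for w
    by (simp add: poly_pcompose)
  \<comment> \<open>Only the constants \<open>poly A 0\<close> and \<open>poly D 1\<close> survive
    on the diagonal. Subtracting the identity puts their difference into the corner, so they agree;
    this is the scalar \<open>c\<close> of the model.\<close>
  have "(\<lambda>w. mat2 (poly A 0) 0 0 (d w)) \<in> T"
    by (rule T_lin[OF ad poly_in_T(1)[of A'], where c = 1 and d = "-1"])
       (simp add: mat2_simps a_eq)
  then have "(\<lambda>w. mat2 (poly A 0) 0 0 (poly D 1)) \<in> T"
    by (rule T_lin[OF _ poly_in_T(4)[of "pcompose D' [:1, 1:]"], where c = 1 and d = "-1"])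
       (simp add: mat2_simps d_eq shift)
  then have "(\<lambda>w. mat2 (poly A 0 - poly D 1) 0 0 0) \<in> T"
    by (rule T_lin[OF _ T_one, where c = 1 and d = "- poly D 1"]) (simp add: mat2_simps)
  then have AD: "poly A 0 = poly D 1"
    using T_const by fastforce
  \<comment> \<open>Multiplication by \<open>e(3)\<close> on the right and on the left sends
    \<open>b\<close> to both corners. The second product shows that \<open>b\<close> is a polynomial
    in \<open>x\<close>, and comparison with the first that it vanishes at 0.\<close>
  have "(\<lambda>w. mat2 (b w * (x w - 1)) 0 0 0) \<in> T"
    by (rule T_cong[OF T_mult[OF b e(3)]]) (simp add: mat2_simps)
  from T_11_vanish[OF this] obtain B1 where B1: "\<And>w. b w * (x w - 1) = x w * poly B1 (x w)"
    by blast
  have "(\<lambda>w. mat2 0 0 0 ((x w - 1) * b w)) \<in> T"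
    by (rule T_cong[OF T_mult[OF e(3) b]]) (simp add: mat2_simps)
  from T_22_vanish[OF this] obtain B2 where "\<And>w. (x w - 1) * b w = (x w - 1) * poly B2 (x w)"
    by blast
  then have B2: "b w = poly B2 (x w)" for w
    using x_neq(2)[of w] by (metis mult_left_cancel right_minus_eq)
  have "[:-1, 1:] * B2 = [:0, 1:] * B1"
    by (rule poly_eq_if_eq_on_infinite[OF inj_x])
       (use B1 in \<open>simp add: B2[symmetric] algebra_simps\<close>)
  then have "poly ([:-1, 1:] * B2) 0 = poly ([:0, 1:] * B1) 0"
    by simp
  then have "poly B2 0 = 0"
    by simp
  with poly_split_at[of B2 0] obtain B where B: "B2 = [:0, 1:] * B"
    by auto
  \<comment> \<open>The same argument with \<open>e(2)\<close>: \<open>c\<close> is a polynomial in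
    \<open>x\<close> that vanishes at 1.\<close>
  have "(\<lambda>w. mat2 0 0 0 (c w * x w)) \<in> T"
    by (rule T_cong[OF T_mult[OF c e(2)]]) (simp add: mat2_simps)
  from T_22_vanish[OF this] obtain C1 where C1: "\<And>w. c w * x w = (x w - 1) * poly C1 (x w)"
    by blast
  have "(\<lambda>w. mat2 (x w * c w) 0 0 0) \<in> T"
    by (rule T_cong[OF T_mult[OF e(2) c]]) (simp add: mat2_simps)
  from T_11_vanish[OF this] obtain C2 where "\<And>w. x w * c w = x w * poly C2 (x w)"
    by blast
  then have C2: "c w = poly C2 (x w)" for w
    using x_neq(1)[of w] by (metis mult_left_cancel)
  have "[:0, 1:] * C2 = [:-1, 1:] * C1"
    by (rule poly_eq_if_eq_on_infinite[OF inj_x])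
       (use C1 in \<open>simp add: C2[symmetric] algebra_simps\<close>)
  then have "poly ([:0, 1:] * C2) 1 = poly ([:-1, 1:] * C1) 1"
    by simp
  then have "poly C2 1 = 0"
    by simp
  with poly_split_at[of C2 1] obtain C where C: "C2 = [:-1, 1:] * C"
    by auto
  let ?M = "mscale [:poly A 0:] (mat 1) + mat2 [:0, 1:] 0 0 [:-1, 1:] ** mat2 A' B C D'"
  show ?thesis
  proof (intro bexI allI)
    show "?M \<in> model"
      by (auto simp: model_def)
    show "L w = mpeval ?M (x w)" for w
      unfolding L a_eq d_eq B2 B C2 C AD
      by (simp add: mpeval_mat2 mat2_simps algebra_simps)
  qed
qed

end

section \<open>Algebra isomorphisms\<close>

definition model_algebra :: "(complex, mpoly) module" where
  "model_algebra = \<lparr>carrier = model, mult = (**), one = mat 1, zero = 0, add = (+),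
     smult = \<lambda>c. mscale [:c:]\<rparr>"

lemma alg_iso_trans:
  assumes "f \<in> alg_iso A B" "g \<in> alg_iso B C"
  shows "g \<circ> f \<in> alg_iso A C"
  using assms ring_iso_set_trans[of f A B g C]
  by (auto simp: alg_iso_def ring_iso_def ring_hom_def Pi_iff)

lemma alg_iso_sym:
  assumes "ring A" and closed: "\<And>c x. x \<in> carrier A \<Longrightarrow> c \<odot>\<^bsub>A\<^esub> x \<in> carrier A"
    and h: "h \<in> alg_iso A B"
  shows "inv_into (carrier A) h \<in> alg_iso B A"
proof -
  let ?g = "inv_into (carrier A) h"
  have iso: "h \<in> ring_iso A B" and smult: "\<And>c x. x \<in> carrier A \<Longrightarrow> h (c \<odot>\<^bsub>A\<^esub> x) = c \<odot>\<^bsub>B\<^esub> h x"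
    using h by (auto simp: alg_iso_def)
  have bij: "bij_betw h (carrier A) (carrier B)"
    using iso by (simp add: ring_iso_def)
  have "?g (c \<odot>\<^bsub>B\<^esub> y) = c \<odot>\<^bsub>A\<^esub> ?g y" if "y \<in> carrier B" for c y
  proof -
    have "?g y \<in> carrier A" "h (?g y) = y"
      using bij that by (auto simp: bij_betw_def intro: inv_into_into f_inv_into_f)
    then show ?thesis
      using smult closed bij by (metis bij_betw_def inv_into_f_f)
  qed
  then show ?thesis
    using ring_iso_set_sym[OF assms(1) iso] by (simp add: alg_iso_def)
qed

lemma DO_smult_closed: "D \<in> DO S U \<Longrightarrow> dscale c D \<in> DO S U"
  unfolding DO_def by (auto simp: act_dscale) (metis mconst_mscale mscale_mult_left)

text \<open>\<open>H\<close> need not be monic. Normalizing the Darboux rows would conjugate the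
  eigenvalues by a matrix depending on \<open>w\<close> and spoil their polynomial form.\<close>

definition spectrum :: "(nat \<Rightarrow> mpoly) \<Rightarrow> (nat \<Rightarrow> cmat) set" where
  "spectrum H = {L. \<exists>D. \<forall>w. act D (H w) = mconst (L w) ** H w}"

lemma spectrum_add:
  assumes "L \<in> spectrum H" "M \<in> spectrum H"
  shows "(\<lambda>w. L w + M w) \<in> spectrum H"
proof -
  obtain D E where "\<And>w. act D (H w) = mconst (L w) ** H w" "\<And>w. act E (H w) = mconst (M w) ** H w"
    using assms by (auto simp: spectrum_def)
  then have "act (D + E) (H w) = mconst (L w + M w) ** H w" for w
    by (simp add: act_add mconst_add matrix_add_rdistrib_mpoly)
  then show ?thesis
    by (auto simp: spectrum_def)
qed

lemma spectrum_mult: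
  assumes "L \<in> spectrum H" "M \<in> spectrum H"
  shows "(\<lambda>w. L w ** M w) \<in> spectrum H"
proof -
  obtain D E where "\<And>w. act D (H w) = mconst (L w) ** H w" "\<And>w. act E (H w) = mconst (M w) ** H w"
    using assms by (auto simp: spectrum_def)
  then have "act (dmult D E) (H w) = mconst (L w ** M w) ** H w" for w
    by (simp add: act_dmult act_mconst mconst_mult matrix_mul_assoc)
  then show ?thesis
    by (auto simp: spectrum_def)
qed

lemma spectrum_scale:
  assumes "L \<in> spectrum H"
  shows "(\<lambda>w. mscale c (L w)) \<in> spectrum H"
proof -
  obtain D where "\<And>w. act D (H w) = mconst (L w) ** H w"
    using assms by (auto simp: spectrum_def)
  then have "act (dscale c D) (H w) = mconst (mscale c (L w)) ** H w" for w
    by (simp add: act_dscale mconst_mscale mscale_mult_left)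
  then show ?thesis
    by (auto simp: spectrum_def)
qed

lemma spectrum_one: "(\<lambda>w. mat 1) \<in> spectrum H"
proof -
  have "act [:mat 1:] (H w) = mconst (mat 1) ** H w" for w
    by (simp add: act_one mconst_1)
  then show ?thesis
    unfolding spectrum_def by blast
qed

text \<open>The relation \<open>P\<close> between operators and matrix polynomials is one-to-one:
  \<open>H_regular\<close> and injectivity of \<open>x\<close> determine \<open>M\<close> from
  \<open>D\<close>, and \<open>act_inj\<close> determines \<open>D\<close> from \<open>M\<close>.
  Because operators act on the right, eigenvalues multiply in the same order as operators.\<close>

lemma DO_algebra_iso_model:
  assumes DO: "DO S U = {D. \<forall>w. \<exists>L. act D (H w) = mconst L ** H w}"
    and act_inj: "\<And>D. (\<And>w. act D (H w) = 0) \<Longrightarrow> D = 0"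
    and H_regular: "\<And>w L. mconst L ** H w = 0 \<Longrightarrow> L = 0"
    and x: "inj x"
    and spec: "spectrum H = {\<lambda>w. mpeval M (x w) |M. M \<in> model}"
  shows "\<exists>h. h \<in> alg_iso (DO_algebra S U) model_algebra"
proof -
  define P where "P D M \<longleftrightarrow> (\<forall>w. act D (H w) = mconst (mpeval M (x w)) ** H w)" for D M
  have P_right: "M = N" if "P D M" "P D N" for D M N
  proof (rule mpeval_inject[OF x])
    fix w
    have "mconst (mpeval M (x w)) ** H w = mconst (mpeval N (x w)) ** H w"
      using that by (simp add: P_def)
    moreover have "mconst (A - B) = mconst A - mconst B" for A B
      by (simp add: mat_eq_iff_2 mconst_def)
    ultimately have "mconst (mpeval M (x w) - mpeval N (x w)) ** H w = 0"
      by (simp add: matrix_mult_minus_left)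
    from H_regular[OF this] show "mpeval M (x w) = mpeval N (x w)"
      by simp
  qed
  have P_left: "D = E" if "P D M" "P E M" for D E M
  proof -
    have "act (D - E) (H w) = 0" for w
      using act_add[of "D - E" E "H w"] that by (simp add: P_def)
    then show ?thesis
      using act_inj by fastforce
  qed
  have ex_M: "\<exists>M\<in>model. P D M" if "D \<in> DO S U" for D
  proof -
    from that DO have "\<exists>L. \<forall>w. act D (H w) = mconst (L w) ** H w"
      by (auto intro: choice)
    then obtain L where L: "\<And>w. act D (H w) = mconst (L w) ** H w"
      by blast
    then have "L \<in> spectrum H"
      by (auto simp: spectrum_def)
    with spec L show ?thesis
      by (auto simp: P_def)
  qed
  have ex_D: "\<exists>D\<in>DO S U. P D M" if "M \<in> model" for M
  proof -
    have "(\<lambda>w. mpeval M (x w)) \<in> spectrum H"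
      using spec that by auto
    then show ?thesis
      unfolding spectrum_def DO P_def by blast
  qed
  obtain h where h: "\<And>D. D \<in> DO S U \<Longrightarrow> h D \<in> model \<and> P D (h D)"
    using ex_M by metis
  have h_eq: "h D = M" if "D \<in> DO S U" "P D M" for D M
    using h P_right that by blast
  have bij: "bij_betw h (DO S U) model"
  proof (rule bij_betwI')
    show "h D = h E \<longleftrightarrow> D = E" if "D \<in> DO S U" "E \<in> DO S U" for D E
      using h P_left that by metis
    show "h D \<in> model" if "D \<in> DO S U" for D
      using h that by blast
    show "\<exists>D\<in>DO S U. M = h D" if "M \<in> model" for M
      using ex_D[OF that] h_eq by blast
  qed
  interpret R: ring "DO_algebra S U"
    by (rule ring_DO_algebra)
  have closed: "dmult D E \<in> DO S U" "D + E \<in> DO S U" if "D \<in> DO S U" "E \<in> DO S U" for D E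
    using R.m_closed[of D E] R.a_closed[of D E] that by (simp_all add: DO_algebra_def)
  have one: "[:mat 1:] \<in> DO S U"
    using R.one_closed by (simp add: DO_algebra_def)
  have "h (dmult D E) = h D ** h E" "h (D + E) = h D + h E" if "D \<in> DO S U" "E \<in> DO S U" for D E
    using h[OF that(1)] h[OF that(2)]
    by (auto intro!: h_eq closed that simp: P_def act_dmult act_mconst act_add mpeval_mult
        mpeval_add mconst_mult mconst_add matrix_mul_assoc matrix_add_rdistrib_mpoly)
  moreover have "h [:mat 1:] = mat 1"
    by (rule h_eq[OF one]) (simp add: P_def act_one mpeval_1 mconst_1)
  moreover have "h (dscale c D) = mscale [:c:] (h D)" if "D \<in> DO S U" for c D
    using h[OF that]
    by (auto intro!: h_eq DO_smult_closed that simp: P_def act_dscale mpeval_mscale mconst_mscale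
        mscale_mult_left)
  ultimately have "h \<in> alg_iso (DO_algebra S U) model_algebra"
    using bij h by (auto simp: alg_iso_def ring_iso_def ring_hom_def DO_algebra_def model_algebra_def)
  then show ?thesis
    by blast
qed

section \<open>Classical orthogonal polynomials\<close>

text \<open>The value forced by the coefficient of \<open>x^w\<close> in the differential equation
  \<open>sl_ode\<close> for a monic solution of degree \<open>w\<close>.\<close>

definition sl_eigenvalue :: "real \<Rightarrow> real \<Rightarrow> nat \<Rightarrow> real" where
  "sl_eigenvalue \<theta> \<nu> w = real w * (\<nu> + \<theta> * (real w + 1))"

definition sigma :: "real \<Rightarrow> complex poly" where
  "sigma \<theta> = [:1, 0, - of_real \<theta>:]"

text \<open>If \<open>\<omega>' \<sigma> = - \<nu> x \<omega> - \<sigma>' \<omega>\<close> (Pearson's equation), then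
  \<open>\<omega>\<close> times this polynomial is the derivative of \<open>\<omega> \<sigma> h\<close>.\<close>

definition pearson :: "real \<Rightarrow> real \<Rightarrow> complex poly \<Rightarrow> complex poly" where
  "pearson \<theta> \<nu> h = sigma \<theta> * pderiv h - [:0, of_real \<nu>:] * h"

text \<open>Coefficients of the monic solution of degree \<open>w\<close> of
  \<open>(1 - \<theta> x\<^sup>2) G'' - (\<nu> + 2 \<theta>) x G' + y\<^sub>w G = 0\<close>: Gegenbauer polynomials for \<open>\<theta> = 1\<close> and
  Hermite polynomials for \<open>\<theta> = 0\<close>.\<close>

function sl_coeff :: "real \<Rightarrow> real \<Rightarrow> nat \<Rightarrow> nat \<Rightarrow> real" where
  "sl_coeff \<theta> \<nu> w k = (if k > w then 0 else if k = w then 1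
     else real ((k + 2) * (k + 1)) / (sl_eigenvalue \<theta> \<nu> k - sl_eigenvalue \<theta> \<nu> w)
       * sl_coeff \<theta> \<nu> w (k + 2))"
  by pat_completeness auto
termination
  by (relation "Wellfounded.measure (\<lambda>(\<theta>, \<nu>, w, k). Suc w - k)") auto

declare sl_coeff.simps [simp del]

definition sl_poly :: "real \<Rightarrow> real \<Rightarrow> nat \<Rightarrow> complex poly" where
  "sl_poly \<theta> \<nu> w = (\<Sum>k\<le>w. monom (of_real (sl_coeff \<theta> \<nu> w k)) k)"

lemma coeff_sl_poly: "coeff (sl_poly \<theta> \<nu> w) k = of_real (sl_coeff \<theta> \<nu> w k)"
  by (simp add: sl_poly_def coeff_sum sl_coeff.simps[of \<theta> \<nu> w k])

lemma sl_coeff_top [simp]: "sl_coeff \<theta> \<nu> w w = 1"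
  by (simp add: sl_coeff.simps)

lemma sl_coeff_beyond: "k > w \<Longrightarrow> sl_coeff \<theta> \<nu> w k = 0"
  by (simp add: sl_coeff.simps)

lemma sl_coeff_below_top: "sl_coeff \<theta> \<nu> (Suc w) w = 0"
  by (simp add: sl_coeff.simps[of \<theta> \<nu> "Suc w" w] sl_coeff_beyond)

lemma degree_sl_poly: "degree (sl_poly \<theta> \<nu> w) = w"
proof (rule antisym)
  show "degree (sl_poly \<theta> \<nu> w) \<le> w"
    by (rule degree_le) (simp add: coeff_sl_poly sl_coeff_beyond)
  show "w \<le> degree (sl_poly \<theta> \<nu> w)"
    by (rule le_degree) (simp add: coeff_sl_poly)
qed

lemma sl_poly_neq_0 [simp]: "sl_poly \<theta> \<nu> w \<noteq> 0"
  using coeff_sl_poly[of \<theta> \<nu> w w] by auto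

definition real_poly :: "complex poly \<Rightarrow> bool" where
  "real_poly f \<longleftrightarrow> map_poly cnj f = f"

lemma real_poly_sl_poly: "real_poly (sl_poly \<theta> \<nu> w)"
  by (simp add: real_poly_def poly_eq_iff coeff_map_poly coeff_sl_poly)

lemma map_poly_cnj_add: "map_poly cnj (f + g) = map_poly cnj f + map_poly cnj g"
  by (simp add: poly_eq_iff coeff_map_poly)

lemma map_poly_cnj_smult: "map_poly cnj (Polynomial.smult c f) = Polynomial.smult (cnj c) (map_poly cnj f)"
  by (simp add: poly_eq_iff coeff_map_poly)

lemma map_poly_cnj_pderiv: "map_poly cnj (pderiv f) = pderiv (map_poly cnj f)"
  by (simp add: poly_eq_iff coeff_map_poly coeff_pderiv)

lemma map_poly_cnj_pCons_0: "map_poly cnj (pCons 0 f) = pCons 0 (map_poly cnj f)"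
  by (simp add: map_poly_pCons)

locale sl_family =
  fixes \<theta> \<nu> :: real
  assumes theta_nonneg: "0 \<le> \<theta>" and nu_pos: "0 < \<nu>"
begin

abbreviation y :: "nat \<Rightarrow> real" where "y \<equiv> sl_eigenvalue \<theta> \<nu>"
abbreviation G :: "nat \<Rightarrow> complex poly" where "G \<equiv> sl_poly \<theta> \<nu>"
abbreviation \<sigma> :: "complex poly" where "\<sigma> \<equiv> sigma \<theta>"
abbreviation \<tau> :: real where "\<tau> \<equiv> \<nu> + 2 * \<theta>"

lemma y_less: "v < w \<Longrightarrow> y v < y w"
  using theta_nonneg nu_pos unfolding sl_eigenvalue_def
  by (intro mult_less_le_imp_less add_left_mono mult_left_mono) (auto intro: add_pos_nonneg)

lemma y_eq_iff [simp]: "y v = y w \<longleftrightarrow> v = w"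
  using y_less by (metis less_irrefl linorder_neqE_nat)

lemma y_nonneg: "0 \<le> y w"
  using theta_nonneg nu_pos unfolding sl_eigenvalue_def by simp

text \<open>The denominators in \<open>sl_coeff\<close> are nonzero because \<open>y\<close> is
  strictly increasing; for \<open>k\<close> at least \<open>w\<close> both sides are 0.\<close>

lemma sl_coeff_rec:
  "real ((k + 2) * (k + 1)) * sl_coeff \<theta> \<nu> w (k + 2) = (y k - y w) * sl_coeff \<theta> \<nu> w k"
  using sl_coeff.simps[of \<theta> \<nu> w k] y_eq_iff[of k w] sl_coeff_beyond[of w "k + 2" \<theta> \<nu>]
  by (auto simp: not_less less_Suc_eq_le)

lemma sl_ode:
  "\<sigma> * pderiv (pderiv (G w)) - [:0, of_real \<tau>:] * pderiv (G w) + [:of_real (y w):] * G w = 0"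
proof (rule poly_eqI)
  fix k
  have rec: "of_nat ((k + 2) * (k + 1)) * coeff (G w) (k + 2) = of_real (y k - y w) * coeff (G w) k"
    using arg_cong[OF sl_coeff_rec, of complex_of_real k w] by (simp add: coeff_sl_poly)
  let ?g = "coeff (G w)"
  have "coeff (\<sigma> * pderiv (pderiv (G w)) - [:0, of_real \<tau>:] * pderiv (G w) + [:of_real (y w):] * G w) k
      = of_nat ((k + 2) * (k + 1)) * ?g (k + 2) - of_real (y k) * ?g k + of_real (y w) * ?g k"
  proof (cases k)
    case 0
    then show ?thesis
      by (simp add: sigma_def coeff_pderiv sl_eigenvalue_def numeral_2_eq_2)
  next
    case (Suc l)
    show ?thesis
    proof (cases l)
      case 0
      then show ?thesis
        unfolding Suc by (simp add: sigma_def coeff_pderiv sl_eigenvalue_def numeral_3_eq_3 algebra_simps)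
    next
      case (Suc m)
      have "m + 4 = Suc (Suc (Suc (Suc m)))"
        by simp
      then show ?thesis
        unfolding \<open>k = Suc l\<close> Suc
        by (simp add: sigma_def coeff_pderiv sl_eigenvalue_def algebra_simps)
    qed
  qed
  then show "coeff (\<sigma> * pderiv (pderiv (G w)) - [:0, of_real \<tau>:] * pderiv (G w)
      + [:of_real (y w):] * G w) k = coeff 0 k"
    unfolding rec by (simp add: algebra_simps)
qed

lemma pderiv_sigma: "pderiv \<sigma> = - 2 * [:0, of_real \<theta>:]"
  by (simp add: sigma_def pderiv_pCons numeral_poly)

lemma tau_poly: "[:0, of_real \<tau>:] = [:0, of_real \<nu>:] + 2 * [:0, of_real \<theta> :: complex:]"
  by (simp add: numeral_poly)

text \<open>Integration by parts before integrating. Multiplied by a weight \<omega> satisfying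
  Pearson's equation, the left side is the derivative of \<omega> times
  \<open>\<sigma> * \<sigma> * pderiv (G w) * g\<close>, and the differential equation removes the
  second derivative.\<close>

lemma pearson_sigma_deriv:
  "pearson \<theta> \<nu> (\<sigma> * pderiv (G w) * g) =
     \<sigma> * \<sigma> * pderiv (G w) * pderiv g - [:of_real (y w):] * (\<sigma> * G w * g)"
proof -
  have "\<sigma> * pderiv (pderiv (G w)) = [:0, of_real \<tau>:] * pderiv (G w) - [:of_real (y w):] * G w"
    using sl_ode[of w] by (simp add: algebra_simps del: mult_pCons_left mult_pCons_right)
  then have "\<sigma> * g * (\<sigma> * pderiv (pderiv (G w))) = \<sigma> * g * ([:0, of_real \<tau>:] * pderiv (G w) - [:of_real (y w):] * G w)"
    by (rule arg_cong)
  then show ?thesis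
    unfolding pearson_def pderiv_mult pderiv_sigma tau_poly
    by (simp add: algebra_simps del: mult_pCons_left mult_pCons_right)
qed

end

text \<open>\<open>F\<close> abstracts integration against a weight satisfying Pearson's equation;
  \<open>F_pearson\<close> expresses that boundary terms vanish.\<close>

locale sl_functional = sl_family +
  fixes F :: "complex poly \<Rightarrow> complex"
  assumes F_add: "F (f + g) = F f + F g"
    and F_const: "F ([:c:] * f) = c * F f"
    and F_pearson: "F (pearson \<theta> \<nu> h) = 0"
    and F_pos: "real_poly f \<Longrightarrow> f \<noteq> 0 \<Longrightarrow> F (sigma \<theta> * f * f) \<noteq> 0"
begin

lemma F_diff: "F (f - g) = F f - F g"
  using F_add[of f "[:-1:] * g"] F_const[of "-1" g] by simp

lemma F_deriv: "F (\<sigma> * \<sigma> * pderiv (G w) * pderiv g) = of_real (y w) * F (\<sigma> * G w * g)"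
  using F_pearson[of "\<sigma> * pderiv (G w) * g"]
  unfolding pearson_sigma_deriv F_diff F_const by simp

lemma F_orthogonal:
  assumes "v \<noteq> w"
  shows "F (\<sigma> * G v * G w) = 0"
proof -
  \<comment> \<open>The left side of \<open>F_deriv\<close> is symmetric in the two polynomials, as
    for any self-adjoint operator.\<close>
  have "of_real (y v) * F (\<sigma> * G v * G w) = of_real (y w) * F (\<sigma> * G v * G w)"
    using F_deriv[of v "G w"] F_deriv[of w "G v"] by (simp add: mult.commute mult.left_commute)
  then show ?thesis
    using assms by simp
qed

lemma F_norm: "F (\<sigma> * G w * G w) \<noteq> 0"
  by (intro F_pos real_poly_sl_poly sl_poly_neq_0)

end

section \<open>Leading coefficients of differential operators\<close>

lemma coeff_mult_top:
  fixes f g :: "'a::comm_semiring_0 poly"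
  assumes "degree f \<le> a" "degree g \<le> b"
  shows "coeff (f * g) (a + b) = coeff f a * coeff g b"
proof -
  have "coeff (f * g) (a + b) = (\<Sum>i\<le>a + b. coeff f i * coeff g (a + b - i))"
    by (rule coeff_mult)
  also have "\<dots> = (\<Sum>i\<in>{a}. coeff f i * coeff g (a + b - i))"
  proof (rule sum.mono_neutral_right)
    show "\<forall>i\<in>{..a + b} - {a}. coeff f i * coeff g (a + b - i) = 0"
    proof
      fix i assume i: "i \<in> {..a + b} - {a}"
      then have "i > a \<or> a + b - i > b" by auto
      then show "coeff f i * coeff g (a + b - i) = 0"
        using assms by (auto simp: coeff_eq_0)
    qed
  qed auto
  finally show ?thesis by simp
qed

text \<open>The falling factorial \<open>w (w - 1) ... (w - i + 1)\<close> as a polynomial in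
  \<open>w\<close>, the factor produced by differentiating \<open>x^w\<close> exactly
  \<open>i\<close> times.\<close>

definition falling_poly :: "nat \<Rightarrow> complex poly" where
  "falling_poly i = (\<Prod>k<i. [:- of_nat k, 1:])"

lemma falling_poly_at_less: "w < i \<Longrightarrow> poly (falling_poly i) (of_nat w) = 0"
  by (auto simp: falling_poly_def poly_prod)

lemma falling_poly_at:
  "i \<le> w \<Longrightarrow> poly (falling_poly i) (of_nat w) = pochhammer (of_nat (Suc (w - i))) i"
proof (induction i)
  case (Suc i)
  have "pochhammer (of_nat (Suc (w - Suc i))) (Suc i)
      = (of_nat (w - i) * pochhammer (of_nat (Suc (w - i))) i :: complex)"
    using Suc.prems by (simp add: pochhammer_rec Suc_diff_Suc del: of_nat_Suc) (simp add: add.commute)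
  then show ?case
    using Suc by (simp add: falling_poly_def of_nat_diff algebra_simps)
qed (simp add: falling_poly_def)

lemma degree_higher_pderiv_le: "degree f \<le> w \<Longrightarrow> degree ((pderiv ^^ i) f) \<le> w - i"
  for f :: "complex poly"
  by (rule degree_le) (auto simp: coeff_higher_pderiv intro: coeff_eq_0)

lemma higher_pderiv_eq_0: "degree f < i \<Longrightarrow> (pderiv ^^ i) f = 0" for f :: "complex poly"
  by (auto simp: poly_eq_iff coeff_higher_pderiv intro: coeff_eq_0)

lemma higher_pderiv_top: "degree f \<le> i \<Longrightarrow> (pderiv ^^ i) f = [:fact i * coeff f i:]"
  for f :: "complex poly"
proof (rule poly_eqI)
  fix n assume "degree f \<le> i"
  then show "coeff ((pderiv ^^ i) f) n = coeff [:fact i * coeff f i:] n"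
    by (cases n) (auto simp: coeff_higher_pderiv pochhammer_fact[symmetric] coeff_eq_0)
qed

lemma coeff_higher_pderiv_mult_top:
  fixes f F :: "complex poly"
  assumes "degree f \<le> w" "degree F \<le> i"
  shows "coeff ((pderiv ^^ i) f * F) w = poly (falling_poly i) (of_nat w) * coeff f w * coeff F i"
proof (cases "i \<le> w")
  case True
  have "coeff ((pderiv ^^ i) f * F) (w - i + i) = coeff ((pderiv ^^ i) f) (w - i) * coeff F i"
    by (intro coeff_mult_top degree_higher_pderiv_le assms)
  with True show ?thesis
    by (simp add: coeff_higher_pderiv falling_poly_at)
next
  case False
  then show ?thesis
    using assms by (simp add: higher_pderiv_eq_0 falling_poly_at_less)
qed

text \<open>Since \<open>f\<close> has no term of degree \<open>w\<close>, only its top term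
  contributes, and it meets the coefficient of \<open>F\<close> one below the top. For
  \<open>i = 0\<close> the factor \<open>F\<close> is constant and nothing remains.\<close>

lemma coeff_higher_pderiv_mult_next:
  fixes f F :: "complex poly"
  assumes "degree f \<le> Suc w" "degree F \<le> i" and "coeff f w = 0"
  shows "coeff ((pderiv ^^ i) f * F) w =
    poly (falling_poly i) (of_nat (Suc w)) * coeff f (Suc w) * (if i = 0 then 0 else coeff F (i - 1))"
proof -
  define f' where "f' = f - monom (coeff f (Suc w)) (Suc w)"
  have f: "f = f' + monom (coeff f (Suc w)) (Suc w)"
    by (simp add: f'_def)
  have "coeff f' k = 0" if "k \<ge> w" for k
    using that assms(1,3) le_antisym[of w k]
    by (cases "k = w"; cases "k = Suc w") (auto simp: f'_def coeff_eq_0)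
  then have "degree f' \<le> w" "coeff f' w = 0"
    by (auto intro!: degree_le)
  then have f'_0: "coeff ((pderiv ^^ i) f' * F) w = 0"
    using coeff_higher_pderiv_mult_top[of f' w F i] assms(2) by simp
  have pd_add: "(pderiv ^^ i) (a + c) = (pderiv ^^ i) a + (pderiv ^^ i) c" for a c :: "complex poly"
    by (simp add: poly_eq_iff coeff_higher_pderiv distrib_left)
  show ?thesis
  proof (cases "i \<le> Suc w")
    case True
    have "(pderiv ^^ i) (monom c (Suc w)) = monom (poly (falling_poly i) (of_nat (Suc w)) * c) (Suc w - i)" for c
      using True by (auto simp: poly_eq_iff coeff_higher_pderiv falling_poly_at Suc_diff_le simp del: of_nat_Suc)
    then have "coeff ((pderiv ^^ i) (monom (coeff f (Suc w)) (Suc w)) * F) w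
        = poly (falling_poly i) (of_nat (Suc w)) * coeff f (Suc w) * (if i = 0 then 0 else coeff F (i - 1))"
      using True by (auto simp: coeff_monom_mult)
    then show ?thesis
      by (subst f) (simp add: pd_add f'_0 distrib_right)
  next
    case False
    then show ?thesis
      using assms(1) falling_poly_at_less[of "Suc w" i] by (simp add: higher_pderiv_eq_0)
  qed
qed

lemma act_nth:
  assumes "degree D \<le> N"
  shows "act D P $ k $ l = (\<Sum>i\<le>N. (pderiv ^^ i) (P $ k $ 1) * coeff D i $ 1 $ l
    + (pderiv ^^ i) (P $ k $ 2) * coeff D i $ 2 $ l)"
  using assms by (simp add: act_bound matrix_mult_nth_2 mderiv_pow_nth)

section \<open>The eigenvalue algebra of a Darboux family\<close>

text \<open>Stated with opaque ring elements so that \<open>algebra_simps\<close> need not handle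
  \<open>pCons\<close>. Here \<open>g\<close>, \<open>g1\<close>, \<open>g2\<close> are
  \<open>G w\<close> and its derivatives, \<open>c\<close> is the conjugate of \<open>b\<close>,
  \<open>S\<close> is \<sigma> and \<open>t\<close> is \<tau> times the variable. The third identity
  inserts the differential equation.\<close>

lemma darboux_ring_identities:
  fixes p r p' s b c g g1 g2 t P Y S X :: "'a::comm_ring_1"
  shows "(p * g + X * r * g1) * (p' + s) + ((p * g1 + (r * g1 + X * r * g2)) * (X * s) + b * g2 * - c)
      = (X * r * (X * s) - b * c) * g2 + X * (s * p + r * p' + 2 * r * s) * g1 + p * (p' + s) * g"
    and "(p' * g + X * s * g1) * (p + r) + (c * g2 * - b + (p' * g1 + (s * g1 + X * s * g2)) * (X * r))
      = (X * r * (X * s) - b * c) * g2 + X * (s * p + r * p' + 2 * r * s) * g1 + p' * (p + r) * g"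
    and "(b * c * (1 - S) - b * c) * g2 + b * c * t * g1 + P * g
      = (b * c * Y + P) * g - b * c * (S * g2 - t * g1 + Y * g)"
    and "b * g1 * (p + r) + ((p * g1 + (r * g1 + X * r * g2)) * - b + b * g2 * (X * r)) = 0"
    and "c * g1 * (p' + s) + (c * g2 * (X * s) + (p' * g1 + (s * g1 + X * s * g2)) * - c) = 0"
  by (simp_all add: algebra_simps)

text \<open>The rows of the matrix below are obtained from the eigenfunction \<open>G w\<close> of a second order scalar
  operator by two first order operators, collected in \<open>\<Phi>\<close>; the operator \<open>\<Psi>\<close> goes back.
  For the Gegenbauer weight \<open>r = s = b = 1\<close> and \<open>p' = n - p\<close>; for the Hermite weight \<open>p = p' = 1\<close>,
  \<open>r = 0\<close>, \<open>s = |a|\<^sup>2 / 2\<close> and \<open>b = - a / 2\<close>.\<close>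

locale darboux_family = sl_family +
  fixes p r p' s :: real and b :: complex
  assumes theta: "\<theta> = 0 \<or> \<theta> = 1"
    and pos: "0 < p" "0 < p'" "0 \<le> r" "0 < s" and b_neq_0: "b \<noteq> 0"
    and second_order: "r * s = \<theta> * (norm b)\<^sup>2"
    and first_order: "s * p + r * p' + 2 * r * s = \<tau> * (norm b)\<^sup>2"
    and gap: "p * s \<noteq> p' * r"
begin

definition hat :: "complex poly \<Rightarrow> mpoly" where
  "hat f = mat2 ([:of_real p:] * f + [:0, of_real r:] * pderiv f) ([:b:] * pderiv f)
     ([:cnj b:] * pderiv f) ([:of_real p':] * f + [:0, of_real s:] * pderiv f)"

abbreviation H :: "nat \<Rightarrow> mpoly" where "H w \<equiv> hat (G w)"

definition \<Phi> :: diffop where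
  "\<Phi> = [: mat2 [:of_real p:] 0 0 [:of_real p':], mat2 [:0, of_real r:] [:b:] [:cnj b:] [:0, of_real s:] :]"

definition \<Psi> :: diffop where
  "\<Psi> = [: mat2 [:of_real (p' + s):] 0 0 [:of_real (p + r):],
     mat2 [:0, of_real s:] [:- b:] [:- cnj b:] [:0, of_real r:] :]"

definition X1 :: "nat \<Rightarrow> real" where "X1 w = (norm b)\<^sup>2 * y w + p * (p' + s)"
definition X2 :: "nat \<Rightarrow> real" where "X2 w = (norm b)\<^sup>2 * y w + p' * (p + r)"
text \<open>\<open>X1 w - X2 w\<close> equals the denominator, so after this scaling the two
  eigenvalues differ by exactly 1, whatever the parameters.\<close>

definition x :: "nat \<Rightarrow> complex" where "x w = of_real (X1 w / (p * s - p' * r))"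

lemma act_first_order: "act [:A, B:] P = P ** A + mderiv P ** B"
  by (subst act_bound[of _ 1]) auto

lemma act_const: "act [:A:] P = P ** A"
  by (subst act_bound[of _ 0]) auto

lemma act_\<Phi>: "act \<Phi> (mat2 f 0 0 f) = hat f"
  by (simp add: \<Phi>_def act_first_order hat_def mat_eq_iff_2 matrix_mult_nth_2 mderiv_def mult.commute)

lemma norm_b: "complex_of_real ((norm b)\<^sup>2) = b * cnj b"
  by (rule complex_norm_square)

lemma poly_second_order:
  "[:0, of_real r:] * [:0, of_real s:] = ([:b:] * [:cnj b:]) * (1 - sigma \<theta>)"
proof -
  have "complex_of_real (r * s) = of_real \<theta> * (b * cnj b)"
    unfolding second_order of_real_mult norm_b ..
  then show ?thesis
    by (simp add: sigma_def one_pCons algebra_simps)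
qed

lemma poly_first_order:
  "[:0, of_real (s * p + r * p' + 2 * r * s):] = ([:b:] * [:cnj b:]) * [:0, of_real \<tau>:]"
  unfolding first_order of_real_mult norm_b by (simp add: mult.commute)

text \<open>The off-diagonal entries cancel. On the diagonal, \<open>second_order\<close> and
  \<open>first_order\<close> turn the terms with derivatives into \<open>- |b|^2\<close> times those
  of the differential equation, which leaves a multiple of \<open>G w\<close>.\<close>

lemma act_\<Psi>: "act \<Psi> (H w) = mat2 ([:of_real (X1 w):] * G w) 0 0 ([:of_real (X2 w):] * G w)"
proof -
  let ?C = "\<lambda>c. [:complex_of_real c:]" and ?X = "[:0, 1:] :: complex poly"
  have lin: "[:0, of_real c:] = ?X * ?C c" for c
    by simp
  have X1: "?C (X1 w) = ([:b:] * [:cnj b:]) * ?C (y w) + ?C p * (?C p' + ?C s)"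
    and X2: "?C (X2 w) = ([:b:] * [:cnj b:]) * ?C (y w) + ?C p' * (?C p + ?C r)"
    unfolding X1_def X2_def of_real_add of_real_mult norm_b by simp_all
  let ?g = "G w" and ?g1 = "pderiv (G w)" and ?g2 = "pderiv (pderiv (G w))"
  note ode = sl_ode[of w]
  have pX: "pderiv (?X * ?C c * f) = ?C c * f + ?X * ?C c * pderiv f" for c f
    by (simp add: pderiv_mult pderiv_pCons pderiv_smult)
  have pC: "pderiv ([:c:] * f) = [:c:] * pderiv f" for c :: complex and f
    by (simp add: pderiv_smult)
  have CC: "?C (c + d) = ?C c + ?C d" "?C (c * d) = ?C c * ?C d" "?C 2 = 2" for c d
    by (simp_all add: numeral_poly)
  have so: "?X * ?C r * (?X * ?C s) = ([:b:] * [:cnj b:]) * (1 - \<sigma>)"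
    using poly_second_order unfolding lin .
  have fo: "?X * (?C s * ?C p + ?C r * ?C p' + 2 * ?C r * ?C s) = ([:b:] * [:cnj b:]) * [:0, of_real \<tau>:]"
  proof -
    have "?X * (?C s * ?C p + ?C r * ?C p' + 2 * ?C r * ?C s) = [:0, of_real (s * p + r * p' + 2 * r * s):]"
      unfolding CC[symmetric] by simp
    then show ?thesis
      unfolding poly_first_order .
  qed
  have neg: "[:- c:] = - [:c:]" for c :: complex
    by simp
  note unf = \<Psi>_def act_first_order hat_def mat_eq_iff_2 matrix_mult_nth_2 mderiv_def
    nth_map_matrix vector_add_component mat2_nth
  have e11: "act \<Psi> (H w) $ 1 $ 1 = [:of_real (X1 w):] * G w"
  proof -
    have "act \<Psi> (H w) $ 1 $ 1 = (?X * ?C r * (?X * ?C s) - [:b:] * [:cnj b:]) * ?g2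
        + ?X * (?C s * ?C p + ?C r * ?C p' + 2 * ?C r * ?C s) * ?g1 + ?C p * (?C p' + ?C s) * ?g"
      unfolding unf lin pderiv_add pX pC CC neg mult_zero_right add_0_left add_0_right by (rule darboux_ring_identities(1))
    also have "\<dots> = [:of_real (X1 w):] * G w - ([:b:] * [:cnj b:]) *
        (\<sigma> * ?g2 - [:0, of_real \<tau>:] * ?g1 + [:of_real (y w):] * ?g)"
      unfolding so fo X1 by (rule darboux_ring_identities(3))
    finally show ?thesis
      unfolding ode by simp
  qed
  have e22: "act \<Psi> (H w) $ 2 $ 2 = [:of_real (X2 w):] * G w"
  proof -
    have "act \<Psi> (H w) $ 2 $ 2 = (?X * ?C r * (?X * ?C s) - [:b:] * [:cnj b:]) * ?g2
        + ?X * (?C s * ?C p + ?C r * ?C p' + 2 * ?C r * ?C s) * ?g1 + ?C p' * (?C p + ?C r) * ?g"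
      unfolding unf lin pderiv_add pX pC CC neg mult_zero_right add_0_left add_0_right by (rule darboux_ring_identities(2))
    also have "\<dots> = [:of_real (X2 w):] * G w - ([:b:] * [:cnj b:]) *
        (\<sigma> * ?g2 - [:0, of_real \<tau>:] * ?g1 + [:of_real (y w):] * ?g)"
      unfolding so fo X2 by (rule darboux_ring_identities(3))
    finally show ?thesis
      unfolding ode by simp
  qed
  have e12: "act \<Psi> (H w) $ 1 $ 2 = 0" "act \<Psi> (H w) $ 2 $ 1 = 0"
    unfolding unf lin pderiv_add pX pC CC neg mult_zero_right add_0_left add_0_right by (rule darboux_ring_identities(4) darboux_ring_identities(5))+
  show ?thesis
    unfolding mat_eq_iff_2 e11 e22 e12 by simp
qed

lemma gap_complex: "complex_of_real (p * s - p' * r) \<noteq> 0"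
  using gap by (simp del: of_real_diff of_real_mult)

lemma x_minus_1: "x w - 1 = of_real (X2 w / (p * s - p' * r))"
proof -
  have "X1 w / (p * s - p' * r) - 1 = X2 w / (p * s - p' * r)"
    using gap by (simp add: X1_def X2_def field_simps)
  then show ?thesis
    unfolding x_def by (metis of_real_1 of_real_diff)
qed

lemma X_pos: "0 < X1 w" "0 < X2 w"
proof -
  have "0 \<le> (norm b)\<^sup>2 * y w" "0 < p * (p' + s)" "0 < p' * (p + r)"
    using pos y_nonneg[of w] by (simp_all add: add_pos_nonneg)
  then show "0 < X1 w" "0 < X2 w"
    by (simp_all add: X1_def X2_def)
qed

lemma x_neq: "x w \<noteq> 0" "x w \<noteq> 1"
proof -
  show "x w \<noteq> 0"
    using X_pos(1)[of w] gap_complex by (simp add: x_def del: of_real_diff of_real_mult)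
  have "x w - 1 \<noteq> 0"
    using X_pos(2)[of w] gap_complex unfolding x_minus_1 by (simp del: of_real_diff of_real_mult)
  then show "x w \<noteq> 1"
    by simp
qed

lemma inj_x: "inj x"
proof (rule injI)
  fix v w assume "x v = x w"
  then have "X1 v = X1 w"
    unfolding x_def of_real_eq_iff using gap by simp
  then show "v = w"
    using b_neq_0 by (simp add: X1_def)
qed

text \<open>Go back with \<Psi>, multiply by a constant matrix, return with \<Phi>. In between
  stands a constant diagonal matrix times the scalar \<open>G w\<close>, which commutes with
  \<open>C\<close>.\<close>

lemma gen_in_spectrum: "(\<lambda>w. mat2 (x w) 0 0 (x w - 1) ** C) \<in> spectrum H"
proof -
  define d where "d = complex_of_real (p * s - p' * r)"
  have d: "d \<noteq> 0"
    using gap_complex by (simp add: d_def del: of_real_diff of_real_mult)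
  define D where "D = dmult \<Psi> (dmult [:mconst (mscale (1 / d) C):] \<Phi>)"
  have "act D (H w) = mconst (mat2 (x w) 0 0 (x w - 1) ** C) ** H w" for w
  proof -
    let ?X = "mat2 (of_real (X1 w)) 0 0 (of_real (X2 w)) :: cmat"
    have X: "act \<Psi> (H w) = mconst ?X ** mat2 (G w) 0 0 (G w)"
      by (simp add: act_\<Psi> mconst_mat2 mat2_mult)
    have comm: "mat2 f 0 0 f ** A = A ** mat2 f 0 0 f" for f :: "complex poly" and A :: mpoly
      by (simp add: mat_eq_iff_2 matrix_mult_nth_2 mult.commute)
    have "act D (H w) = mconst (?X ** mscale (1 / d) C) ** H w"
      unfolding D_def act_dmult X act_mconst act_const comm
      by (simp add: act_mconst act_\<Phi> mconst_mult matrix_mul_assoc)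
    also have "?X ** mscale (1 / d) C = mat2 (x w) 0 0 (x w - 1) ** C"
      unfolding x_minus_1 using d by (simp add: x_def d_def[symmetric] of_real_divide mat_eq_iff_2 matrix_mult_nth_2 mscale_def del: of_real_diff of_real_mult)
    finally show ?thesis .
  qed
  then show ?thesis
    by (auto simp: spectrum_def)
qed

end

section \<open>Operators and eigenvalues read off from leading coefficients\<close>

context darboux_family
begin

lemma coeff_below_top: "coeff (G (Suc w)) w = 0"
  by (simp add: coeff_sl_poly sl_coeff_below_top)

lemma hat_nth [simp]:
  "hat f $ 1 $ 1 = [:of_real p:] * f + [:0, of_real r:] * pderiv f" "hat f $ 1 $ 2 = [:b:] * pderiv f"
  "hat f $ 2 $ 1 = [:cnj b:] * pderiv f" "hat f $ 2 $ 2 = [:of_real p':] * f + [:0, of_real s:] * pderiv f"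
  by (simp_all add: hat_def)

definition lead :: "nat \<Rightarrow> 2 \<Rightarrow> complex" where
  "lead w k = (if k = 1 then of_real (p + r * w) else of_real (p' + s * w))"

lemma lead_neq_0 [simp]: "lead w k \<noteq> 0"
proof -
  have "0 < p + r * w" "0 < p' + s * w"
    using pos by (auto intro: add_pos_nonneg)
  then show ?thesis
    unfolding lead_def by (simp only: of_real_eq_0_iff split: if_split) auto
qed

lemma degree_H_le: "degree (H w $ k $ l) \<le> w"
proof (rule degree_le, intro allI impI)
  fix i assume "w < i"
  then have "coeff (G w) i = 0" "coeff (G w) (Suc i) = 0"
    by (simp_all add: coeff_sl_poly sl_coeff_beyond)
  with \<open>w < i\<close> show "coeff (H w $ k $ l) i = 0"
    using exhaust_2[of k] exhaust_2[of l] by (cases i) (auto simp: coeff_pderiv)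
qed

lemma coeff_H_top: "coeff (H w $ k $ l) w = (if k = l then lead w k else 0)"
proof -
  have "coeff (G w) (Suc w) = 0" "coeff (G w) w = 1"
    by (simp_all add: coeff_sl_poly sl_coeff_beyond)
  then show ?thesis
    using exhaust_2[of k] exhaust_2[of l]
    by (cases w) (auto simp: lead_def coeff_pderiv coeff_pCons)
qed

lemma coeff_H_22: "coeff (H (Suc w) $ 2 $ 2) w = 0"
  using coeff_below_top[of w] by (cases w) (auto simp: coeff_pderiv)

lemma degree_H_21_le: "degree (H (Suc w) $ 2 $ 1) \<le> w"
  using degree_pderiv[of "G (Suc w)"] degree_smult_le[of "cnj b" "pderiv (G (Suc w))"]
  by (simp add: degree_sl_poly)

lemma coeff_H_21: "coeff (H (Suc w) $ 2 $ 1) w = cnj b * of_nat (Suc w)"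
  by (simp add: coeff_pderiv coeff_sl_poly)

lemma H_regular:
  assumes "mconst L ** H w = 0"
  shows "L = 0"
proof -
  have "L $ k $ l * lead w l = 0" for k l
  proof -
    have "coeff ((mconst L ** H w) $ k $ l) w = L $ k $ l * lead w l"
      using exhaust_2[of l]
      by (auto simp: matrix_mult_nth_2 mconst_def coeff_H_top simp del: hat_nth)
    with assms show ?thesis
      by simp
  qed
  then show ?thesis
    by (simp add: vec_eq_iff)
qed

text \<open>Applied to \<open>H i\<close>, the terms of order above \<open>i\<close> vanish and the
  term of order \<open>i\<close> meets an invertible constant diagonal matrix. So the coefficients
  of \<open>D\<close> can be solved for one after another, which gives both
  \<open>act_H_inject\<close> and \<open>degree_coeff_le\<close>.\<close>

lemma coeff_from_act:
  "[:fact i * lead i k:] * coeff D i $ k $ l = act D (H i) $ k $ l -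
     (\<Sum>j<i. (pderiv ^^ j) (H i $ k $ 1) * coeff D j $ 1 $ l + (pderiv ^^ j) (H i $ k $ 2) * coeff D j $ 2 $ l)"
proof -
  let ?t = "\<lambda>j. (pderiv ^^ j) (H i $ k $ 1) * coeff D j $ 1 $ l + (pderiv ^^ j) (H i $ k $ 2) * coeff D j $ 2 $ l"
  have "act D (H i) $ k $ l = sum ?t {..max i (degree D)}"
    by (rule act_nth) simp
  also have "\<dots> = sum ?t {..i}"
  proof (rule sum.mono_neutral_right)
    have "(pderiv ^^ j) (H i $ k $ m) = 0" if "i < j" for j m
      using degree_H_le[of i k m] that by (simp add: higher_pderiv_eq_0 del: hat_nth)
    then show "\<forall>j\<in>{..max i (degree D)} - {..i}. ?t j = 0"
      by (auto simp del: hat_nth)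
  qed auto
  also have "\<dots> = sum ?t {..<i} + ?t i"
    by (simp add: lessThan_Suc_atMost[symmetric] del: hat_nth)
  also have "?t i = [:fact i * lead i k:] * coeff D i $ k $ l"
    using exhaust_2[of k]
    by (auto simp: higher_pderiv_top degree_H_le coeff_H_top simp del: hat_nth)
  finally show ?thesis
    by simp
qed

lemma act_H_inject:
  assumes "\<And>w. act D (H w) = 0"
  shows "D = 0"
proof (rule poly_eqI)
  fix i
  show "coeff D i = coeff 0 i"
  proof (induction i rule: less_induct)
    case (less i)
    have "[:fact i * lead i k:] * coeff D i $ k $ l = 0" for k l
      unfolding coeff_from_act assms using less.IH by simp
    then show ?case
      by (simp add: vec_eq_iff)
  qed
qed

lemma degree_coeff_le:
  assumes "\<And>w. act D (H w) = mconst (L w) ** H w"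
  shows "degree (coeff D i $ k $ l) \<le> i"
proof (induction i arbitrary: k l rule: less_induct)
  case (less i)
  have deg_mult: "degree (f * g) \<le> i" if "degree f \<le> i - j" "degree g \<le> j" "j < i" for f g :: "complex poly" and j
    using degree_mult_le[of f g] that by linarith
  have "degree ([:fact i * lead i k:] * coeff D i $ k $ l) \<le> i"
    unfolding coeff_from_act
  proof (intro degree_diff_le degree_sum_le degree_add_le)
    show "degree (act D (H i) $ k $ l) \<le> i"
      unfolding assms matrix_mult_nth_2
      using degree_H_le[of i] by (auto intro!: degree_add_le order_trans[OF degree_smult_le] simp: mconst_def simp del: hat_nth)
  qed (auto intro!: deg_mult degree_higher_pderiv_le degree_H_le less.IH simp del: hat_nth)
  then show ?case
    by (simp add: degree_mult_eq)
qed

text \<open>Compare coefficients of \<open>x^w\<close>. The leading coefficient of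
  \<open>H w\<close> is diagonal, and \<open>degree_coeff_le\<close> makes each order contribute a
  polynomial in \<open>w\<close>.\<close>

lemma eigenvalue_polynomial:
  assumes D: "\<And>w. act D (H w) = mconst (L w) ** H w"
  shows "L w $ k $ l * lead w l = lead w k *
    poly (\<Sum>i\<le>degree D. [:coeff (coeff D i $ k $ l) i:] * falling_poly i) (of_nat w)"
proof -
  have "L w $ k $ l * lead w l = coeff (act D (H w) $ k $ l) w"
    unfolding D using exhaust_2[of l] by (auto simp: matrix_mult_nth_2 mconst_def coeff_H_top simp del: hat_nth)
  also have "\<dots> = (\<Sum>i\<le>degree D. lead w k * (poly (falling_poly i) (of_nat w) * coeff (coeff D i $ k $ l) i))"
    unfolding act_nth[OF order_refl] coeff_sum coeff_add
      coeff_higher_pderiv_mult_top[OF degree_H_le degree_coeff_le[OF D]] coeff_H_top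
    using exhaust_2[of k] by (intro sum.cong) auto
  finally show ?thesis
    by (simp add: poly_sum sum_distrib_left mult.commute)
qed

text \<open>The second row of \<open>act D (H (w + 1))\<close> is zero. The coefficient of
  \<open>x^w\<close> in its first entry gives a polynomial identity in \<open>w + 1\<close> between
  a multiple of \<open>c\<close> and a multiple of \<open>lead (w + 1) 2\<close>.\<close>

lemma spectrum_const:
  assumes "(\<lambda>w. mat2 c 0 0 0) \<in> spectrum H"
  shows "c = 0"
proof -
  obtain D where D: "\<And>w. act D (H w) = mconst (mat2 c 0 0 0) ** H w"
    using assms by (auto simp: spectrum_def)
  define R where "R k l = (\<Sum>i\<le>degree D. [:coeff (coeff D i $ k $ l) i:] * falling_poly i)" for k l
  define Q where "Q = (\<Sum>i\<le>degree D. falling_poly i * [:if i = 0 then 0 else coeff (coeff D i $ 2 $ 1) (i - 1):])"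
  have R: "poly (R 1 1) (of_nat w) = c" for w
    using eigenvalue_polynomial[OF D, where w = w and k = 1 and l = 1] by (simp add: R_def mult.commute)
  have eq: "poly ([:0, c * cnj b:] + [:of_real p', of_real s:] * Q) (of_nat (Suc w)) = 0" for w
  proof -
    have "act D (H (Suc w)) $ 2 $ 1 = 0"
      unfolding D by (simp add: mconst_mat2 matrix_mult_nth_2)
    then have "0 = coeff (act D (H (Suc w)) $ 2 $ 1) w"
      by simp
    also have "\<dots> = (\<Sum>i\<le>degree D. cnj b * of_nat (Suc w) * (poly (falling_poly i) (of_nat w) * coeff (coeff D i $ 1 $ 1) i)
        + lead (Suc w) 2 * (poly (falling_poly i) (of_nat (Suc w)) *
            (if i = 0 then 0 else coeff (coeff D i $ 2 $ 1) (i - 1))))"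
      unfolding act_nth[OF order_refl] coeff_sum coeff_add
        coeff_higher_pderiv_mult_top[OF degree_H_21_le degree_coeff_le[OF D]] coeff_H_21
        coeff_higher_pderiv_mult_next[OF degree_H_le degree_coeff_le[OF D] coeff_H_22] coeff_H_top
      by (intro sum.cong) (simp_all only: refl if_True mult.assoc mult.left_commute mult.commute)
    also have "\<dots> = cnj b * of_nat (Suc w) * poly (R 1 1) (of_nat w) + lead (Suc w) 2 * poly Q (of_nat (Suc w))"
      by (simp add: sum.distrib sum_distrib_left[symmetric] R_def Q_def poly_sum mult.commute)
    finally show ?thesis
      unfolding R by (simp add: lead_def algebra_simps)
  qed
  have "[:0, c * cnj b:] + [:of_real p', of_real s:] * Q = 0"
    by (rule poly_eq_if_eq_on_infinite[where x = "\<lambda>w. of_nat (Suc w)"])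
       (use eq in \<open>auto intro: injI simp del: of_nat_Suc\<close>)
  \<comment> \<open>At the root of the linear factor the unknown \<open>Q\<close> disappears; the
    root is nonzero because \<open>p'\<close> is, so \<open>c\<close> must vanish.\<close>
  then have "poly ([:0, c * cnj b:] + [:of_real p', of_real s:] * Q) (- of_real p' / of_real s) = 0"
    by simp
  then show ?thesis
    using pos b_neq_0 by simp
qed

end

section \<open>Derivatives of the eigenfunctions and their values at the end point 1\<close>

lemma (in sl_family) higher_ode:
  "\<sigma> * (pderiv ^^ (k + 2)) (G w) - [:0, of_real (\<tau> + 2 * \<theta> * k):] * (pderiv ^^ (k + 1)) (G w)
     + [:of_real (y w - y k):] * (pderiv ^^ k) (G w) = 0"
proof (induction k)
  case 0
  then show ?case
    using sl_ode[of w] by (simp add: sl_eigenvalue_def)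
next
  case (Suc k)
  \<comment> \<open>Differentiating the middle term lowers the zeroth order coefficient by exactly
    the increment of \<open>y\<close>.\<close>
  have y_Suc: "y (Suc k) = y k + (\<tau> + 2 * \<theta> * k)"
    by (simp add: sl_eigenvalue_def algebra_simps)
  have pd: "pderiv [:0, of_real c:] = [:of_real c:]" "pderiv [:of_real c:] = 0" for c
    by (simp_all add: pderiv_pCons)
  have c1: "[:0, of_real (\<tau> + 2 * \<theta> * Suc k):] = [:0, of_real (\<tau> + 2 * \<theta> * k):] + 2 * [:0, of_real \<theta> :: complex:]"
    by (simp add: numeral_poly algebra_simps)
  have c2: "[:of_real (y w - y (Suc k)):] = [:of_real (y w - y k):] - [:of_real (\<tau> + 2 * \<theta> * k) :: complex:]"
    unfolding y_Suc by (simp add: algebra_simps)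
  have ids: "\<sigma> * g3 - (A + 2 * B) * g2 + (Y - C) * g1
      = (\<sigma> * g3 + g2 * (- 2 * B)) - (A * g2 + g1 * C) + (Y * g1 + g0 * 0)"
    for g0 g1 g2 g3 A B C Y :: "complex poly"
    by (simp add: algebra_simps)
  have "0 = pderiv (\<sigma> * (pderiv ^^ (k + 2)) (G w) - [:0, of_real (\<tau> + 2 * \<theta> * k):] * (pderiv ^^ (k + 1)) (G w)
     + [:of_real (y w - y k):] * (pderiv ^^ k) (G w))"
    unfolding Suc.IH by simp
  also have "\<dots> = \<sigma> * (pderiv ^^ (Suc k + 2)) (G w) - [:0, of_real (\<tau> + 2 * \<theta> * Suc k):] * (pderiv ^^ (Suc k + 1)) (G w)
     + [:of_real (y w - y (Suc k)):] * (pderiv ^^ Suc k) (G w)"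
    unfolding pderiv_add pderiv_diff pderiv_mult pd pderiv_sigma c1 c2
    by (simp only: funpow.simps o_apply add_Suc_right add_Suc add_2_eq_Suc' add.right_neutral Suc_eq_plus1[symmetric])
      (rule ids[symmetric])
  finally show ?case ..
qed

context darboux_family
begin

lemma poly_in_y_imp_poly_in_x:
  assumes "\<And>w. e w = poly R (of_real (y w))"
  shows "\<exists>R'. \<forall>w. e w = poly R' (x w)"
proof -
  let ?d = "p * s - p' * r" and ?c = "(norm b)\<^sup>2"
  have "y w = - (p * (p' + s)) / ?c + X1 w / ?d * (?d / ?c)" for w
    using gap b_neq_0 by (simp add: X1_def field_simps)
  then have "of_real (y w) = of_real (- (p * (p' + s)) / ?c) + x w * of_real (?d / ?c)" for w
    unfolding x_def by (metis of_real_add of_real_mult)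
  then have "e w = poly (pcompose R [:of_real (- (p * (p' + s)) / ?c), of_real (?d / ?c):]) (x w)" for w
    unfolding assms poly_pcompose by simp
  then show ?thesis
    by blast
qed

text \<open>The factor \<open>poly (G w) 1\<close> is kept because \<open>G w\<close> is normalized
  as monic, not by its value at 1. The property survives differentiation and multiplication by a
  polynomial independent of \<open>w\<close>, hence passes from \<open>G w\<close> to
  \<open>H w\<close> and \<open>act D (H w)\<close>.\<close>

definition taylor_poly :: "(nat \<Rightarrow> complex poly) \<Rightarrow> bool" where
  "taylor_poly f \<longleftrightarrow> (\<forall>i. \<exists>R. \<forall>w. poly ((pderiv ^^ i) (f w)) 1 = poly (G w) 1 * poly R (of_real (y w)))"

lemma higher_pderiv_add: "(pderiv ^^ i) (f + g) = (pderiv ^^ i) f + (pderiv ^^ i) g" for f g :: "complex poly"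
  by (induction i) (simp_all add: pderiv_add)

lemma taylor_poly_add:
  assumes "taylor_poly f" "taylor_poly g"
  shows "taylor_poly (\<lambda>w. f w + g w)"
  unfolding taylor_poly_def
proof
  fix i
  obtain R S where "\<And>w. poly ((pderiv ^^ i) (f w)) 1 = poly (G w) 1 * poly R (of_real (y w))"
    "\<And>w. poly ((pderiv ^^ i) (g w)) 1 = poly (G w) 1 * poly S (of_real (y w))"
    using assms unfolding taylor_poly_def by meson
  then show "\<exists>R. \<forall>w. poly ((pderiv ^^ i) (f w + g w)) 1 = poly (G w) 1 * poly R (of_real (y w))"
    by (intro exI[of _ "R + S"]) (simp add: higher_pderiv_add algebra_simps)
qed

lemma taylor_poly_0: "taylor_poly (\<lambda>w. 0)"
  unfolding taylor_poly_def by (auto intro!: exI[of _ 0] simp: higher_pderiv_eq_0 poly_eq_iff[of _ 0] coeff_higher_pderiv)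

lemma taylor_poly_sum: "(\<And>i. i \<in> I \<Longrightarrow> taylor_poly (f i)) \<Longrightarrow> taylor_poly (\<lambda>w. \<Sum>i\<in>I. f i w)"
  by (induction I rule: infinite_finite_induct) (auto simp: taylor_poly_0 intro: taylor_poly_add)

lemma taylor_poly_pderiv: "taylor_poly f \<Longrightarrow> taylor_poly (\<lambda>w. pderiv (f w))"
  unfolding taylor_poly_def funpow_swap1[symmetric] by (metis funpow.simps(2) o_apply)

lemma taylor_poly_higher_pderiv: "taylor_poly f \<Longrightarrow> taylor_poly (\<lambda>w. (pderiv ^^ i) (f w))"
  by (induction i) (auto intro: taylor_poly_pderiv)

lemma taylor_poly_smult:
  assumes "taylor_poly f"
  shows "taylor_poly (\<lambda>w. Polynomial.smult c (f w))"
  unfolding taylor_poly_def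
proof
  fix i
  obtain R where "\<And>w. poly ((pderiv ^^ i) (f w)) 1 = poly (G w) 1 * poly R (of_real (y w))"
    using assms unfolding taylor_poly_def by meson
  moreover have "(pderiv ^^ i) (Polynomial.smult c g) = Polynomial.smult c ((pderiv ^^ i) g)" for g :: "complex poly"
    by (induction i) (simp_all add: pderiv_smult)
  ultimately show "\<exists>R. \<forall>w. poly ((pderiv ^^ i) (Polynomial.smult c (f w))) 1 = poly (G w) 1 * poly R (of_real (y w))"
    by (intro exI[of _ "Polynomial.smult c R"]) simp
qed

lemma taylor_poly_pCons:
  assumes "taylor_poly f"
  shows "taylor_poly (\<lambda>w. pCons 0 (f w))"
  unfolding taylor_poly_def
proof
  fix i
  have leibniz: "(pderiv ^^ i) (pCons 0 g) = pCons 0 ((pderiv ^^ i) g) + of_nat i * (pderiv ^^ (i - 1)) g" for g :: "complex poly"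
  proof (induction i)
    case (Suc i)
    then show ?case
      by (cases i) (simp_all add: pderiv_add pderiv_pCons pderiv_mult algebra_simps)
  qed simp
  obtain R where "\<And>w. poly ((pderiv ^^ i) (f w)) 1 = poly (G w) 1 * poly R (of_real (y w))"
    using assms unfolding taylor_poly_def by meson
  moreover obtain S where "\<And>w. poly ((pderiv ^^ (i - 1)) (f w)) 1 = poly (G w) 1 * poly S (of_real (y w))"
    using assms unfolding taylor_poly_def by meson
  ultimately show "\<exists>R. \<forall>w. poly ((pderiv ^^ i) (pCons 0 (f w))) 1 = poly (G w) 1 * poly R (of_real (y w))"
    by (intro exI[of _ "R + Polynomial.smult (of_nat i) S"]) (simp add: leibniz algebra_simps)
qed

lemma taylor_poly_mult:
  assumes "taylor_poly f"
  shows "taylor_poly (\<lambda>w. f w * q)"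
proof (induction q)
  case 0
  show ?case
    by (simp add: taylor_poly_0)
next
  case (pCons c q)
  have "taylor_poly (\<lambda>w. Polynomial.smult c (f w) + pCons 0 (f w * q))"
    by (intro taylor_poly_add taylor_poly_smult taylor_poly_pCons assms pCons.IH)
  then show ?case
    by (simp add: mult.commute)
qed

text \<open>For \<theta> = 1 the point 1 is a root of \<sigma>, so the differentiated equation loses
  its highest derivative there and becomes a two-term recursion.\<close>

lemma higher_pderiv_at_1:
  assumes "\<theta> = 1"
  shows "poly ((pderiv ^^ Suc i) (G w)) 1 = of_real ((y w - y i) / (\<tau> + 2 * i)) * poly ((pderiv ^^ i) (G w)) 1"
proof -
  have "\<tau> + 2 * i > 0"
    using theta_nonneg nu_pos by (simp add: add_pos_nonneg)
  moreover have "of_real (\<tau> + 2 * i) * poly ((pderiv ^^ Suc i) (G w)) 1 = of_real (y w - y i) * poly ((pderiv ^^ i) (G w)) 1"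
    using arg_cong[OF higher_ode[of i w], of "\<lambda>f. poly f 1"] assms by (simp add: sigma_def algebra_simps)
  ultimately show ?thesis
    by (simp only: of_real_divide) (simp add: field_simps del: of_real_add of_real_mult of_real_diff)
qed

lemma taylor_poly_G:
  assumes "\<theta> = 1"
  shows "taylor_poly G"
  unfolding taylor_poly_def
proof
  fix i
  show "\<exists>R. \<forall>w. poly ((pderiv ^^ i) (G w)) 1 = poly (G w) 1 * poly R (of_real (y w))"
  proof (induction i)
    case 0
    show ?case
      by (auto intro!: exI[of _ 1])
  next
    case (Suc i)
    then obtain R where R: "\<And>w. poly ((pderiv ^^ i) (G w)) 1 = poly (G w) 1 * poly R (of_real (y w))"
      by blast
    let ?c = "complex_of_real (1 / (\<tau> + 2 * i))"
    have "poly ((pderiv ^^ Suc i) (G w)) 1 = poly (G w) 1 * poly ([:- of_real (y i) * ?c, ?c:] * R) (of_real (y w))" for w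
      unfolding higher_pderiv_at_1[OF assms] R by (simp add: diff_divide_distrib algebra_simps)
    then show ?case
      by blast
  qed
qed

text \<open>Otherwise the recursion kills every derivative at 1, including the one of order
  \<open>w\<close>, which is the constant \<open>w!\<close>.\<close>

lemma G_at_1:
  assumes "\<theta> = 1"
  shows "poly (G w) 1 \<noteq> 0"
proof
  assume 0: "poly (G w) 1 = 0"
  have "poly ((pderiv ^^ i) (G w)) 1 = 0" for i
    by (induction i) (use 0 higher_pderiv_at_1[OF assms] in auto)
  from this[of w] show False
    by (simp add: higher_pderiv_top degree_sl_poly coeff_sl_poly)
qed

text \<open>For \<theta> = 0 the eigenvalue \<open>y w\<close> is linear in \<open>w\<close>, so
  polynomials in \<open>w\<close> suffice. For \<theta> = 1 it is quadratic, and evaluation at 1 is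
  what yields a polynomial in \<open>y w\<close> itself.\<close>

lemma diagonal_entry_polynomial:
  assumes L: "L \<in> spectrum H" and zero: "\<And>w. L w $ k $ l = 0" and "k \<noteq> l"
  shows "\<exists>R. \<forall>w. L w $ k $ k = poly R (x w)"
proof -
  obtain D where D: "\<And>w. act D (H w) = mconst (L w) ** H w"
    using L by (auto simp: spectrum_def)
  from theta show ?thesis
  proof
    assume th: "\<theta> = 0"
    obtain R where R: "\<And>w. L w $ k $ k * lead w k = lead w k * poly R (of_nat w)"
      using eigenvalue_polynomial[OF D] by blast
    have "of_nat w = of_real (y w) * complex_of_real (1 / \<nu>)" for w
      using nu_pos th by (simp add: sl_eigenvalue_def)
    then have "L w $ k $ k = poly (pcompose R [:0, of_real (1 / \<nu>):]) (of_real (y w))" for w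
      using R[of w] by (simp add: poly_pcompose)
    then show ?thesis
      by (rule poly_in_y_imp_poly_in_x)
  next
    assume th: "\<theta> = 1"
    note G = taylor_poly_G[OF th]
    have H: "taylor_poly (\<lambda>w. H w $ i $ j)" for i j
      using exhaust_2[of i] exhaust_2[of j]
      by (auto intro!: taylor_poly_add taylor_poly_smult taylor_poly_pCons taylor_poly_pderiv G)
    have "taylor_poly (\<lambda>w. act D (H w) $ i $ j)" for i j
      unfolding act_nth[OF order_refl]
      by (intro taylor_poly_sum taylor_poly_add taylor_poly_mult taylor_poly_higher_pderiv H)
    then have "\<exists>R. \<forall>w. poly (act D (H w) $ i $ j) 1 = poly (G w) 1 * poly R (of_real (y w))" for i j
      unfolding taylor_poly_def by (metis funpow_0)
    then obtain R where R: "\<And>i j w. poly (act D (H w) $ i $ j) 1 = poly (G w) 1 * poly (R i j) (of_real (y w))"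
      by metis
    have act_k: "poly (act D (H w) $ k $ j) 1 = L w $ k $ k * poly (H w $ k $ j) 1" for w j
      unfolding D matrix_mult_nth_2 using zero[of w] \<open>k \<noteq> l\<close> exhaust_2[of k] exhaust_2[of l]
      by (auto simp: mconst_def simp del: hat_nth)
    define u where "u = (if k = 1 then p else p')"
    \<comment> \<open>Chosen so that at the point 1 the entry \<open>H w $ k $ k\<close> minus
      \<open>v\<close> times \<open>H w $ k $ l\<close> loses its derivative term and equals
      \<open>u * G w\<close>.\<close>
    define v where "v = (if k = 1 then of_real r / b else of_real s / cnj b)"
    have u: "u \<noteq> 0"
      using pos by (simp add: u_def)
    have "L w $ k $ k * (of_real u * poly (G w) 1) = poly (act D (H w) $ k $ k) 1 - v * poly (act D (H w) $ k $ l) 1" for w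
      unfolding act_k using \<open>k \<noteq> l\<close> exhaust_2[of k] exhaust_2[of l] b_neq_0
      by (auto simp: u_def v_def field_simps)
    then have *: "L w $ k $ k * of_real u * poly (G w) 1 = (poly (R k k) (of_real (y w)) - v * poly (R k l) (of_real (y w))) * poly (G w) 1" for w
      unfolding R by (simp only: algebra_simps)
    have "L w $ k $ k * of_real u = poly (R k k - Polynomial.smult v (R k l)) (of_real (y w))" for w
      using *[of w] G_at_1[OF th, of w] by simp
    then have "L w $ k $ k = poly (Polynomial.smult (1 / of_real u) (R k k - Polynomial.smult v (R k l))) (of_real (y w))" for w
      using u by (simp add: field_simps)
    then show ?thesis
      by (rule poly_in_y_imp_poly_in_x)
  qed
qed

sublocale eigenvalue_algebra "spectrum H" x
proof
  show "\<exists>R. \<forall>w. e w = poly R (x w)" if "(\<lambda>w. mat2 (e w) 0 0 0) \<in> spectrum H" for e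
    using diagonal_entry_polynomial[OF that, of 1 2] by simp
  show "\<exists>R. \<forall>w. e w = poly R (x w)" if "(\<lambda>w. mat2 0 0 0 (e w)) \<in> spectrum H" for e
    using diagonal_entry_polynomial[OF that, of 2 1] by simp
qed (auto intro: spectrum_add spectrum_mult spectrum_one spectrum_scale gen_in_spectrum inj_x spectrum_const
    simp: x_neq)

lemma spectrum_eq: "spectrum H = {\<lambda>w. mpeval M (x w) |M. M \<in> model}"
proof (intro equalityI subsetI)
  fix L assume "L \<in> spectrum H"
  from T_in_model[OF this] show "L \<in> {\<lambda>w. mpeval M (x w) |M. M \<in> model}"
    by (auto simp: fun_eq_iff)
qed (auto intro: model_in_T)

end

section \<open>Matrix weights with polynomial part\<close>

definition wint :: "real set \<Rightarrow> (real \<Rightarrow> real) \<Rightarrow> complex poly \<Rightarrow> complex" where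
  "wint S \<omega> f = (LINT x:S|lborel. of_real (\<omega> x) * poly f (of_real x))"

definition mpstar :: "mpoly \<Rightarrow> mpoly" where
  "mpstar P = transpose (map_matrix (map_poly cnj) P)"

lemma meval_mult: "meval (A ** B) t = meval A t ** meval B t"
  by (simp add: mat_eq_iff_2 meval_def matrix_mult_nth_2)

lemma mstar_meval: "mstar (meval R t) = meval (mpstar R) t"
  by (simp add: vec_eq_iff mstar_def mpstar_def meval_def transpose_def)

lemma mult_mscale: "A ** mscale c B = mscale c (A ** B)" "mscale c A ** B = mscale c (A ** B)"
  for A B :: cmat
  by (simp_all add: mat_eq_iff_2 mscale_def matrix_mult_nth_2 distrib_left mult.left_commute mult.assoc)

lemma bounded_linear_axis2: "bounded_linear (\<lambda>z::complex. axis i (axis j z) :: cmat)"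
  unfolding linear_conv_bounded_linear[symmetric]
  by (rule linearI) (auto simp: vec_eq_iff axis_def)

text \<open>Entries may be taken inside the Bochner integral once the matrix function is integrable;
  it is assembled from its integrable entries by \<open>axis\<close>.\<close>

lemma set_integral_matrix_nth:
  fixes f :: "real \<Rightarrow> cmat"
  assumes int: "\<And>i j. set_integrable lborel S (\<lambda>x. f x $ i $ j)"
  shows "(LINT x:S|lborel. f x) $ i $ j = (LINT x:S|lborel. f x $ i $ j)"
proof -
  have f: "indicator S x *\<^sub>R f x = (\<Sum>k\<in>UNIV. \<Sum>l\<in>UNIV. axis k (axis l (indicator S x *\<^sub>R f x $ k $ l)))" for x
    by (simp add: mat_eq_iff_2 axis_def sum_2)
  have "integrable lborel (\<lambda>x. indicator S x *\<^sub>R f x)"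
    unfolding f using int
    by (intro Bochner_Integration.integrable_sum integrable_bounded_linear[OF bounded_linear_axis2])
       (simp add: set_integrable_def)
  then have "(LINT x|lborel. (indicator S x *\<^sub>R f x) $ i $ j) = (LINT x|lborel. indicator S x *\<^sub>R f x) $ i $ j"
    by (intro integral_bounded_linear bounded_linear_compose[OF bounded_linear_vec_nth bounded_linear_vec_nth])
  then show ?thesis
    by (simp add: set_lebesgue_integral_def)
qed

text \<open>Uniqueness by descent: a polynomial of degree below \<open>w\<close> orthogonal to
  \<open>Q 0, ..., Q (w - 1)\<close> is stripped of its top coefficients one by one, each being 0 by
  \<open>nondeg\<close>. The difference of two candidates of degree \<open>w\<close> is of this
  kind.\<close>

lemma mop_eqI:
  assumes Q: "monic_orthogonal S U Q"
    and lin: "\<And>P C P' R. mform S U (P - mconst C ** P') R = mform S U P R - C ** mform S U P' R"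
    and nondeg: "\<And>(C :: cmat) w. C ** mform S U (Q w) (Q w) = 0 \<Longrightarrow> C = 0"
  shows "mop S U = Q"
proof -
  have zero: "P = 0" if "\<forall>k\<ge>w. mcoeff P k = 0" "\<And>v. v < w \<Longrightarrow> mform S U P (Q v) = 0" for P w
    using that
  proof (induction w arbitrary: P)
    case 0
    then show ?case
      by (simp add: mcoeff_def mat_eq_iff_2 poly_eq_iff)
  next
    case (Suc w)
    define C where "C = mcoeff P w"
    have monic: "mcoeff (Q w) w = mat 1" "\<And>k. k > w \<Longrightarrow> mcoeff (Q w) k = 0"
      and orth: "\<And>v. v \<noteq> w \<Longrightarrow> mform S U (Q w) (Q v) = 0"
      using Q by (auto simp: monic_orthogonal_def monic_of_degree_def)
    have coeff_C: "mcoeff (A - mconst C ** B) k = mcoeff A k - C ** mcoeff B k" for A B k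
      by (simp add: mat_eq_iff_2 mcoeff_def mconst_def matrix_mult_nth_2)
    have "P - mconst C ** Q w = 0"
    proof (rule Suc.IH)
      show "\<forall>k\<ge>w. mcoeff (P - mconst C ** Q w) k = 0"
      proof (intro allI impI)
        fix k assume "w \<le> k"
        then show "mcoeff (P - mconst C ** Q w) k = 0"
          using monic Suc.prems(1) unfolding coeff_C
          by (cases "k = w") (auto simp: C_def[symmetric])
      qed
      show "mform S U (P - mconst C ** Q w) (Q v) = 0" if "v < w" for v
        using Suc.prems(2)[of v] orth[of v] that by (simp add: lin)
    qed
    then have P: "P = mconst C ** Q w"
      by simp
    have "mform S U 0 (Q w) = 0"
      using lin[of 0 "mat 1" 0 "Q w"] by (simp add: mconst_1)
    then have "mform S U P (Q w) = C ** mform S U (Q w) (Q w)"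
      using lin[of P C "Q w" "Q w"] P by simp
    then have "C = 0"
      using Suc.prems(2)[of w] by (intro nondeg[of C w]) simp
    then show ?case
      using P by (simp add: mconst_0 matrix_mult_0_left)
  qed
  have "Q' = Q" if Q': "monic_orthogonal S U Q'" for Q'
  proof
    fix w
    show "Q' w = Q w"
    proof (induction w rule: less_induct)
      case (less w)
      have monic: "mcoeff (Q' w) k = mcoeff (Q w) k" if "k \<ge> w" for k
        using that Q Q' by (cases "k = w") (auto simp: monic_orthogonal_def monic_of_degree_def)
      have minus: "mcoeff (Q' w - mconst (mat 1) ** Q w) k = mcoeff (Q' w) k - mcoeff (Q w) k" for k
        by (simp add: mconst_1 mcoeff_def mat_eq_iff_2)
      have "Q' w - mconst (mat 1) ** Q w = 0"
      proof (rule zero)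
        show "\<forall>k\<ge>w. mcoeff (Q' w - mconst (mat 1) ** Q w) k = 0"
          using monic unfolding minus by simp
        show "mform S U (Q' w - mconst (mat 1) ** Q w) (Q v) = 0" if "v < w" for v
        proof -
          have "mform S U (Q' w) (Q' v) = 0" "mform S U (Q w) (Q v) = 0"
            using that Q Q' by (simp_all add: monic_orthogonal_def)
          then show ?thesis
            using less.IH[OF that] by (simp add: lin)
        qed
      qed
      then show ?case
        by (simp add: mconst_1)
    qed
  qed
  with Q show ?thesis
    unfolding mop_def by (rule the_equality)
qed

section \<open>Scalar weights satisfying Pearson's equation\<close>

locale pearson_weight = sl_family +
  fixes S :: "real set" and \<omega> :: "real \<Rightarrow> real"
  assumes S_sets: "S \<in> sets lborel" and S_pos: "emeasure lborel S \<noteq> 0"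
    and integrable: "set_integrable lborel S (\<lambda>x. complex_of_real (\<omega> x) * poly f (of_real x))"
    and wint_pearson: "wint S \<omega> (pearson \<theta> \<nu> h) = 0"
    and weight_pos: "t \<in> S \<Longrightarrow> 0 < \<omega> t" "t \<in> S \<Longrightarrow> 0 < 1 - \<theta> * t\<^sup>2"
begin

lemma wint_add: "wint S \<omega> (f + g) = wint S \<omega> f + wint S \<omega> g"
  unfolding wint_def poly_add distrib_left by (rule set_integral_add(2)[OF integrable integrable])

lemma wint_const: "wint S \<omega> ([:c:] * f) = c * wint S \<omega> f"
proof -
  have "complex_of_real (\<omega> t) * poly ([:c:] * f) (of_real t) = c * (complex_of_real (\<omega> t) * poly f (of_real t))" for t
    by simp
  then show ?thesis
    unfolding wint_def by (simp only: set_integral_mult_right)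
qed

text \<open>The integrand is nonnegative, so a zero integral makes \<open>f\<close> vanish almost
  everywhere on \<open>S\<close>. As \<open>f\<close> has finitely many roots, \<open>S\<close>
  would be a null set.\<close>

lemma wint_pos:
  assumes "real_poly f" "f \<noteq> 0"
  shows "wint S \<omega> (sigma \<theta> * f * f) \<noteq> 0"
proof
  assume 0: "wint S \<omega> (sigma \<theta> * f * f) = 0"
  define g where "g t = \<omega> t * ((1 - \<theta> * t\<^sup>2) * (Re (poly f (of_real t)))\<^sup>2)" for t
  have f: "poly f (of_real t) = of_real (Re (poly f (of_real t)))" for t :: real
  proof -
    have "cnj (poly f (of_real t)) = poly f (of_real t)"
      using poly_cnj[of f "of_real t"] assms(1) by (simp only: real_poly_def complex_cnj_complex_of_real)
    then show ?thesis
      by (simp add: complex_eq_iff)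
  qed
  have "poly (sigma \<theta>) (of_real t) = complex_of_real (1 - \<theta> * t\<^sup>2)" for t :: real
    by (simp add: sigma_def power2_eq_square)
  then have eq: "complex_of_real (\<omega> t) * poly (sigma \<theta> * f * f) (of_real t) = of_real (g t)" for t
    unfolding poly_mult g_def by (subst (1 2) f) (simp add: power2_eq_square)
  have int: "set_integrable lborel S g"
    using integrable_Re[OF integrable[of "sigma \<theta> * f * f", unfolded eq set_integrable_def]]
    by (simp add: set_integrable_def)
  have "complex_of_real (LINT t:S|lborel. g t) = 0"
    using 0 unfolding wint_def eq set_integral_complex_of_real .
  then have "(LINT t|lborel. indicator S t *\<^sub>R g t) = 0"
    by (simp add: set_lebesgue_integral_def)
  moreover have "AE t in lborel. 0 \<le> indicator S t *\<^sub>R g t"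
    using weight_pos by (intro AE_I2) (auto simp: g_def indicator_def less_imp_le)
  ultimately have "AE t in lborel. indicator S t *\<^sub>R g t = 0"
    using int unfolding set_integrable_def by (subst (asm) integral_nonneg_eq_0_iff_AE) auto
  then have "AE t in lborel. t \<in> S \<longrightarrow> poly f (of_real t) = 0"
  proof eventually_elim
    case (elim t)
    then show ?case
      using weight_pos[of t] by (subst f) (auto simp: g_def indicator_def)
  qed
  moreover have "finite {t :: real. poly f (of_real t) = 0}"
    using finite_vimageI[OF poly_roots_finite[OF assms(2)], of complex_of_real]
    by (auto simp: vimage_def inj_on_def)
  then have "{t :: real. poly f (of_real t) = 0} \<in> null_sets lborel"
    by (rule finite_imp_null_set_lborel)
  from AE_not_in[OF this] have "AE t in lborel. poly f (complex_of_real t) \<noteq> 0"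
    by simp
  ultimately have "AE t in lborel. t \<notin> S"
    by eventually_elim auto
  then have "S \<in> null_sets lborel"
    using S_sets by (simp add: AE_iff_null_sets)
  then show False
    using S_pos by auto
qed

sublocale sl_functional \<theta> \<nu> "wint S \<omega>"
proof unfold_locales
  show "wint S \<omega> ([:c:] * f) = c * wint S \<omega> f" for c f
    by (rule wint_const)
qed (rule wint_add wint_pearson wint_pos; assumption)+

lemma mform_nth:
  assumes U: "\<And>t i j. t \<in> S \<Longrightarrow> U t $ i $ j = of_real (\<omega> t) * poly (V $ i $ j) (of_real t)"
  shows "mform S U P R $ i $ j = wint S \<omega> ((P ** V ** mpstar R) $ i $ j)"
proof -
  let ?f = "\<lambda>t. meval P t ** U t ** mstar (meval R t)"
  have f: "?f t $ i $ j = of_real (\<omega> t) * poly ((P ** V ** mpstar R) $ i $ j) (of_real t)" if "t \<in> S" for t i j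
  proof -
    have "U t = mscale (of_real (\<omega> t)) (meval V t)"
      by (simp add: vec_eq_iff U[OF that] mscale_def meval_def)
    then have "?f t = mscale (of_real (\<omega> t)) (meval (P ** V ** mpstar R) t)"
      by (simp add: mstar_meval meval_mult mult_mscale)
    then show ?thesis
      by (simp add: mscale_def meval_def)
  qed
  let ?g = "\<lambda>i j t. complex_of_real (\<omega> t) * poly ((P ** V ** mpstar R) $ i $ j) (of_real t)"
  have "set_integrable lborel S (\<lambda>t. ?f t $ i $ j) \<longleftrightarrow> set_integrable lborel S (?g i j)" for i j
    by (rule set_integrable_cong) (simp_all only: f)
  note this[THEN iffD2, OF integrable]
  from set_integral_matrix_nth[OF this]
  have "mform S U P R $ i $ j = (LINT t:S|lborel. ?f t $ i $ j)"
    unfolding mform_def .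
  also have "\<dots> = (LINT t:S|lborel. ?g i j t)"
    by (rule set_lebesgue_integral_cong) (simp_all add: S_sets[simplified] f)
  finally show ?thesis
    unfolding wint_def .
qed

end

text \<open>\<open>gram\<close> says that, up to total derivatives, the matrix form of
  \<open>hat f\<close> and \<open>hat g\<close> is diagonal and scalar. By \<open>F_deriv\<close>
  both diagonal terms reduce to the orthogonality of the \<open>G w\<close>. The second factor is
  \<open>hat g\<close> and not its adjoint because \<open>H w\<close> is Hermitian.\<close>

locale darboux_weight = darboux_family + pearson_weight +
  fixes U :: "real \<Rightarrow> cmat" and V :: mpoly and K k :: "2 \<Rightarrow> real"
  assumes U: "t \<in> S \<Longrightarrow> U t $ i $ j = of_real (\<omega> t) * poly (V $ i $ j) (of_real t)"
    and K_pos: "0 < K i" and k_nonneg: "0 \<le> k i"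
    and gram: "\<exists>h. (hat f ** V ** hat g) $ i $ j = (if i = j then [:of_real (K i):] * (\<sigma> * f * g)
      + [:of_real (k i):] * (\<sigma> * \<sigma> * pderiv f * pderiv g) else 0) + pearson \<theta> \<nu> h"
begin

abbreviation F :: "complex poly \<Rightarrow> complex" where "F \<equiv> wint S \<omega>"

lemma F_0: "F 0 = 0"
  using F_const[of 0 0] by simp

lemma mform_eq: "mform S U P R $ i $ j = F ((P ** V ** mpstar R) $ i $ j)"
  by (rule mform_nth) (rule U)

lemma mpstar_H: "mpstar (H w) = H w"
  using real_poly_sl_poly[of \<theta> \<nu> w] unfolding real_poly_def
  by (simp add: mat_eq_iff_2 mpstar_def transpose_def map_poly_cnj_add map_poly_cnj_smult
      map_poly_cnj_pderiv map_poly_cnj_pCons_0)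

lemma mform_H: "mform S U (H v) (H w) $ i $ j =
    (if i = j then of_real (K i + k i * y v) * F (\<sigma> * G v * G w) else 0)"
proof -
  obtain h where h: "(H v ** V ** H w) $ i $ j = (if i = j then [:of_real (K i):] * (\<sigma> * G v * G w)
      + [:of_real (k i):] * (\<sigma> * \<sigma> * pderiv (G v) * pderiv (G w)) else 0) + pearson \<theta> \<nu> h"
    using gram by blast
  have "mform S U (H v) (H w) $ i $ j = F ((H v ** V ** H w) $ i $ j)"
    unfolding mform_eq mpstar_H by (rule refl)
  also have "\<dots> = (if i = j then of_real (K i + k i * y v) * F (\<sigma> * G v * G w) else 0)"
    unfolding h F_add F_pearson
    by (simp only: F_add F_const F_deriv F_0 split: if_split) (simp add: algebra_simps)
  finally show ?thesis .
qed

lemma mform_diff: "mform S U (P - mconst C ** P') R = mform S U P R - C ** mform S U P' R"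
proof -
  let ?A = "P ** V ** mpstar R" and ?B = "P' ** V ** mpstar R"
  have *: "(P - mconst C ** P') ** V ** mpstar R = ?A - mconst C ** ?B"
    by (simp add: matrix_mult_minus_left matrix_mul_assoc)
  have "mform S U (P - mconst C ** P') R $ i $ j = (mform S U P R - C ** mform S U P' R) $ i $ j" for i j
    unfolding mform_eq * vector_minus_component F_diff matrix_mult_nth_2[of "mconst C" ?B]
      matrix_mult_nth_2[of C "mform S U P' R"] F_add mconst_nth F_const by (rule refl)
  then show ?thesis
    by (simp add: vec_eq_iff)
qed

lemma mform_mconst: "mform S U (mconst A ** P) (mconst B ** R) = A ** mform S U P R ** mstar B"
proof -
  let ?M = "P ** V ** mpstar R"
  have star: "mpstar (mconst B ** R) = mpstar R ** mconst (mstar B)"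
    by (simp add: mat_eq_iff_2 mpstar_def mstar_def transpose_def matrix_mult_nth_2 mconst_def
        map_poly_cnj_add map_poly_cnj_smult)
  have *: "(mconst A ** P) ** V ** mpstar (mconst B ** R) = mconst A ** ?M ** mconst (mstar B)"
    unfolding star by (simp add: matrix_mul_assoc)
  have F_right: "F (f * [:c:]) = F f * c" for f c
    using F_const[of c f] by (simp add: mult.commute)
  have "mform S U (mconst A ** P) (mconst B ** R) $ i $ j = (A ** mform S U P R ** mstar B) $ i $ j" for i j
    unfolding mform_eq * matrix_mult_nth_2[of "mconst A ** ?M"] matrix_mult_nth_2[of "mconst A" ?M]
      matrix_mult_nth_2[of "A ** mform S U P R"] matrix_mult_nth_2[of A "mform S U P R"]
      F_add mconst_nth F_right F_const by (rule refl)
  then show ?thesis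
    by (simp add: vec_eq_iff)
qed

definition normalizer :: "nat \<Rightarrow> cmat" where
  "normalizer w = mat2 (1 / lead w 1) 0 0 (1 / lead w 2)"

lemma mop_eq: "mop S U = (\<lambda>w. mconst (normalizer w) ** H w)"
proof (rule mop_eqI)
  have mform_Q: "mform S U (mconst (normalizer v) ** H v) (mconst (normalizer w) ** H w) =
      mat2 (of_real (K 1 + k 1 * y v) * F (\<sigma> * G v * G w) / (lead v 1 * cnj (lead w 1))) 0
        0 (of_real (K 2 + k 2 * y v) * F (\<sigma> * G v * G w) / (lead v 2 * cnj (lead w 2)))" for v w
    unfolding mform_mconst
    by (simp add: mat_eq_iff_2 matrix_mult_nth_2 mform_H normalizer_def mstar_def transpose_def)
  show "monic_orthogonal S U (\<lambda>w. mconst (normalizer w) ** H w)"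
    unfolding monic_orthogonal_def
  proof (intro conjI allI impI)
    show "monic_of_degree w (mconst (normalizer w) ** H w)" for w
    proof -
      have "coeff (H w $ i $ j) m = 0" if "m > w" for i j m
        using degree_H_le[of w i j] that by (intro coeff_eq_0) linarith
      then show ?thesis
        unfolding monic_of_degree_def
        by (simp add: mat_eq_iff_2 mcoeff_def matrix_mult_nth_2 normalizer_def mconst_mat2 coeff_H_top mat_def del: hat_nth)
    qed
    show "mform S U (mconst (normalizer v) ** H v) (mconst (normalizer w) ** H w) = 0" if "v \<noteq> w" for v w
      unfolding mform_Q F_orthogonal[OF that] by (simp add: zero_eq_mat2)
  qed
  show "mform S U (P - mconst C ** P') R = mform S U P R - C ** mform S U P' R" for P C P' R
    by (rule mform_diff)
  show "C = 0" if "C ** mform S U (mconst (normalizer w) ** H w) (mconst (normalizer w) ** H w) = 0" for C :: cmat and w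
  proof -
    have "complex_of_real (K i + k i * y w) \<noteq> 0" for i
      using K_pos[of i] k_nonneg[of i] y_nonneg[of w]
      by (subst of_real_eq_0_iff) (simp add: add_pos_nonneg less_imp_neq[symmetric])
    then show ?thesis
      using that F_norm[of w] unfolding mform_Q by (simp add: mat_eq_iff_2 matrix_mult_nth_2 del: of_real_add of_real_mult)
  qed
qed

text \<open>Operators commute with left multiplication by constants, so an invertible constant
  factor merely conjugates the eigenvalue.\<close>

lemma DO_eq: "DO S U = {D. \<forall>w. \<exists>L. act D (H w) = mconst L ** H w}"
proof -
  have inv: "normalizer w ** mat2 (lead w 1) 0 0 (lead w 2) = mat 1"
    "mat2 (lead w 1) 0 0 (lead w 2) ** normalizer w = mat 1" for w
    by (simp_all add: normalizer_def mat2_simps)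
  have "(\<exists>L. act D (mconst (normalizer w) ** H w) = mconst L ** (mconst (normalizer w) ** H w))
      \<longleftrightarrow> (\<exists>L. act D (H w) = mconst L ** H w)" (is "?l \<longleftrightarrow> ?r") for D w
  proof
    let ?N = "normalizer w" and ?M = "mat2 (lead w 1) 0 0 (lead w 2)"
    assume ?l
    then obtain L where "mconst ?N ** act D (H w) = mconst (L ** ?N) ** H w"
      by (auto simp: act_mconst mconst_mult matrix_mul_assoc)
    then have "mconst ?M ** (mconst ?N ** act D (H w)) = mconst ?M ** (mconst (L ** ?N) ** H w)"
      by simp
    then have "act D (H w) = mconst (?M ** L ** ?N) ** H w"
      by (simp add: matrix_mul_assoc mconst_mult[symmetric] inv mconst_1)
    then show ?r ..
  next
    let ?N = "normalizer w" and ?M = "mat2 (lead w 1) 0 0 (lead w 2)"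
    assume ?r
    then obtain L where L: "act D (H w) = mconst L ** H w"
      by blast
    have "?N ** L ** ?M ** ?N = ?N ** L"
      by (simp add: matrix_mul_assoc[symmetric] inv)
    then have "act D (mconst ?N ** H w) = mconst (?N ** L ** ?M) ** (mconst ?N ** H w)"
      unfolding act_mconst L by (simp add: matrix_mul_assoc mconst_mult[symmetric])
    then show ?l ..
  qed
  then show ?thesis
    unfolding DO_def mop_eq by simp
qed

theorem DO_algebra_iso_model: "\<exists>h. h \<in> alg_iso (DO_algebra S U) model_algebra"
  using DO_eq act_H_inject H_regular inj_x spectrum_eq by (rule DO_algebra_iso_model)

end

section \<open>The Hermite weight\<close>

lemma gaussian_moment_even:
  "has_bochner_integral lborel (\<lambda>x::real. exp (- x\<^sup>2) * x ^ (2 * k)) (sqrt pi * (fact (2 * k) / (2 ^ (2 * k) * fact k)))"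
  using has_bochner_integral_even_function[OF gaussian_moment_even_pos[of k]] by simp

lemma gaussian_moment_odd:
  "has_bochner_integral lborel (\<lambda>x::real. exp (- x\<^sup>2) * x ^ (2 * k + 1)) 0"
  by (rule has_bochner_integral_odd_function[OF gaussian_moment_odd_pos[of k]]) simp

lemma gaussian_moment_integrable: "integrable lborel (\<lambda>x::real. exp (- x\<^sup>2) * x ^ k)"
proof (cases "even k")
  case True
  then obtain j where "k = 2 * j" by (elim evenE)
  then show ?thesis
    using gaussian_moment_even[of j] by (simp add: has_bochner_integral_iff)
next
  case False
  then obtain j where "k = 2 * j + 1" by (elim oddE)
  then show ?thesis
    using gaussian_moment_odd[of j] by (simp add: has_bochner_integral_iff)
qed

definition gaussian_moment :: "nat \<Rightarrow> real" where
  "gaussian_moment k = (LINT x|lborel. exp (- x\<^sup>2) * x ^ k)"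

lemma gaussian_moment_1: "gaussian_moment 1 = 0"
  using gaussian_moment_odd[of 0] by (simp add: gaussian_moment_def has_bochner_integral_iff)

lemma gaussian_moment_rec: "2 * gaussian_moment (k + 2) = real (k + 1) * gaussian_moment k"
proof (cases "even k")
  case True
  then obtain j where j: "k = 2 * j" by (elim evenE)
  have "k + 2 = 2 * Suc j"
    by (simp add: j)
  then have "gaussian_moment (k + 2) = sqrt pi * (fact (2 * Suc j) / (2 ^ (2 * Suc j) * fact (Suc j)))"
    "gaussian_moment k = sqrt pi * (fact (2 * j) / (2 ^ (2 * j) * fact j))"
    using gaussian_moment_even[of j] gaussian_moment_even[of "Suc j"]
    by (simp_all only: gaussian_moment_def has_bochner_integral_iff j)
  moreover have "fact (2 * Suc j) = (2 * (real j + 1)) * (2 * real j + 1) * fact (2 * j)"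
    "(2 :: real) ^ (2 * Suc j) = 4 * 2 ^ (2 * j)" "fact (Suc j) = (real j + 1) * fact j"
    by (simp_all add: algebra_simps)
  moreover have "2 * (u * (2 * v * w * F / (4 * P * (v * Q)))) = w * (u * (F / (P * Q)))"
    if "v \<noteq> 0" for u v w F P Q :: real
    using that by (simp add: field_simps)
  ultimately show ?thesis
    by (simp only: j) simp
next
  case False
  then obtain j where j: "k = 2 * j + 1" by (elim oddE)
  have "k + 2 = 2 * Suc j + 1"
    by (simp add: j)
  then have "gaussian_moment (k + 2) = 0" "gaussian_moment k = 0"
    using gaussian_moment_odd[of j] gaussian_moment_odd[of "Suc j"]
    by (simp_all only: gaussian_moment_def has_bochner_integral_iff j)
  then show ?thesis
    by simp
qed

lemma gaussian_poly_expand: "complex_of_real (exp (- t\<^sup>2)) * poly f (of_real t) =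
    (\<Sum>i\<le>degree f. coeff f i * of_real (exp (- t\<^sup>2) * t ^ i))"
  by (simp add: poly_altdef sum_distrib_left mult.left_commute)

lemma gaussian_poly_integrable:
  "integrable lborel (\<lambda>t. complex_of_real (exp (- t\<^sup>2)) * poly f (of_real t))"
  unfolding gaussian_poly_expand
  by (intro Bochner_Integration.integrable_sum integrable_mult_right integrable_of_real gaussian_moment_integrable)

abbreviation gint :: "complex poly \<Rightarrow> complex" where
  "gint \<equiv> wint UNIV (\<lambda>t. exp (- t\<^sup>2))"

lemma gint_monom: "gint (monom c k) = c * of_real (gaussian_moment k)"
proof -
  have "complex_of_real (exp (- t\<^sup>2)) * poly (monom c k) (of_real t) = c * of_real (exp (- t\<^sup>2) * t ^ k)" for t
    by (simp add: poly_monom)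
  then show ?thesis
    unfolding wint_def set_lebesgue_integral_def gaussian_moment_def
    by (simp only: indicator_UNIV scaleR_one integral_mult_right_zero integral_complex_of_real)
qed

lemma gint_add: "gint (f + g) = gint f + gint g"
  unfolding wint_def set_lebesgue_integral_def
  using Bochner_Integration.integral_add[OF gaussian_poly_integrable[of f] gaussian_poly_integrable[of g]]
  by (simp add: distrib_left)

text \<open>Checked on monomials: the image of \<open>x^k\<close> is
  \<open>k x^(k-1) - 2 x^(k+1)\<close>, whose integral vanishes by the moment recursion, or by
  oddness when \<open>k = 0\<close>.\<close>

lemma gint_pearson: "gint (pearson 0 2 h) = 0"
proof -
  have monom: "gint (pearson 0 2 (monom c k)) = 0" for c k
  proof (cases k)
    case 0
    have "pearson 0 2 (monom c k) = monom (- 2 * c) 1"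
      by (simp add: 0 pearson_def sigma_def monom_0 monom_Suc)
    then show ?thesis
      by (simp only: gint_monom gaussian_moment_1 of_real_0 mult_zero_right)
  next
    case (Suc m)
    have "pderiv (monom c k) = monom (of_nat (m + 1) * c) m"
      by (simp add: Suc pderiv_monom)
    moreover have "[:0, of_real 2:] * monom c k = - monom (- 2 * c) (m + 2)"
      by (simp add: Suc monom_Suc smult_monom minus_monom)
    ultimately have "pearson 0 2 (monom c k) = monom (of_nat (m + 1) * c) m + monom (- 2 * c) (m + 2)"
      by (simp only: pearson_def) (simp add: sigma_def)
    then have "gint (pearson 0 2 (monom c k)) =
        c * of_real (real (m + 1) * gaussian_moment m - 2 * gaussian_moment (m + 2))"
      by (simp only: gint_add gint_monom) (simp add: algebra_simps)
    then show ?thesis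
      unfolding gaussian_moment_rec by simp
  qed
  have add: "pearson 0 2 (f + g) = pearson 0 2 f + pearson 0 2 g" for f g
    by (simp add: pearson_def pderiv_add algebra_simps smult_add_right)
  have "gint (pearson 0 2 (\<Sum>i\<in>I. monom (coeff h i) i)) = 0" if "finite I" for I
    using that by induction (simp_all add: add gint_add monom monom[of 0 0, simplified])
  from this[of "{..degree h}"] show ?thesis
    by (simp add: poly_as_sum_of_monoms)
qed

section \<open>Explicit form of the Hermite type weight\<close>

lemma mexp_nilpotent:
  assumes "A ** A = 0"
  shows "mexp A = mat 1 + A"
proof -
  have pow: "mpow A (Suc (Suc k)) = 0" for k
    by (induction k) (simp_all add: mpow_def assms)
  have "mpow A k = 0" if "k \<ge> 2" for k
    using that pow by (metis add_2_eq_Suc le_Suc_ex)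
  then have "mexp A = (\<Sum>k\<in>{0, 1}. mpow A k /\<^sub>R fact k)"
    unfolding mexp_def by (intro suminf_finite) (auto simp: not_less_eq_eq numeral_2_eq_2)
  then show ?thesis
    by (simp add: mpow_def)
qed

lemma scaleR_mat2: "t *\<^sub>R mat2 a b c d = mat2 (of_real t * a) (of_real t * b) (of_real t * c) (of_real t * d)"
  for a b c d :: complex
  by (simp add: mat_eq_iff_2 scaleR_conv_of_real[where 'a = complex])

lemma W_tilde_eq: "W_tilde a t = exp (- t\<^sup>2) *\<^sub>R
    mat2 (1 + (a * cnj a) * of_real (t\<^sup>2)) (a * of_real t) (cnj a * of_real t) 1"
proof -
  let ?M = "vector [vector [0, a], vector [0, 0]] :: cmat"
  have M: "?M = mat2 0 a 0 0"
    by (simp add: mat2_def)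
  have "mexp (t *\<^sub>R ?M) = mat2 1 (a * of_real t) 0 1"
    unfolding M scaleR_mat2 by (subst mexp_nilpotent) (simp_all add: mat2_simps mult.commute)
  moreover have "mstar ?M = mat2 0 0 (cnj a) 0"
    unfolding M by (simp add: mat_eq_iff_2 mstar_def transpose_def)
  then have "mexp (t *\<^sub>R mstar ?M) = mat2 1 0 (cnj a * of_real t) 1"
    by (simp only: scaleR_mat2) (subst mexp_nilpotent; simp add: mat2_simps mult.commute)
  ultimately show ?thesis
    unfolding W_tilde_def Let_def by (simp add: mat2_mult power2_eq_square mult_ac)
qed

lemma hermite_pearson_weight: "pearson_weight 0 2 UNIV (\<lambda>t. exp (- t\<^sup>2))"
proof
  show "set_integrable lborel UNIV (\<lambda>x. complex_of_real (exp (- x\<^sup>2)) * poly f (of_real x))" for f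
    using gaussian_poly_integrable[of f] by (simp add: set_integrable_def)
qed (auto simp: gint_pearson)

text \<open>The entries of \<open>hat f ** V ** hat g\<close> in ring letters, with
  \<open>f'\<close> and \<open>g'\<close> for the derivatives and \<open>C\<close> for the conjugate
  of \<open>B\<close>. The remainders on the right are written in the shape
  \<open>h' - 2 X h\<close> of \<open>pearson 0 2 h\<close>.\<close>

lemma hermite_gram_identities:
  fixes f g f' g' X B C :: "'a::comm_ring_1"
  shows "(f * (1 + 4 * B * C * X * X) + B * f' * (- 2 * C * X)) * g + (f * (- 2 * B * X) + B * f' * 1) * (C * g')
      = (1 + 2 * B * C) * (f * g) + B * C * (f' * g')
        + (- 2 * B * C * (f * g + X * (f' * g + f * g')) - 2 * X * (- 2 * B * C * (X * (f * g))))"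
    and "(f * (1 + 4 * B * C * X * X) + B * f' * (- 2 * C * X)) * (B * g') + (f * (- 2 * B * X) + B * f' * 1) * (g + 2 * B * C * X * g')
      = B * (f' * g + f * g') - 2 * X * (B * (f * g))"
    and "(C * f' * (1 + 4 * B * C * X * X) + (f + 2 * B * C * X * f') * (- 2 * C * X)) * g
        + (C * f' * (- 2 * B * X) + (f + 2 * B * C * X * f') * 1) * (C * g')
      = C * (f' * g + f * g') - 2 * X * (C * (f * g))"
    and "(C * f' * (1 + 4 * B * C * X * X) + (f + 2 * B * C * X * f') * (- 2 * C * X)) * (B * g')
        + (C * f' * (- 2 * B * X) + (f + 2 * B * C * X * f') * 1) * (g + 2 * B * C * X * g')
      = f * g + B * C * (f' * g')"
  by (simp_all add: algebra_simps)

theorem DO_algebra_W_tilde_iso_model: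
  assumes "a \<noteq> 0"
  shows "\<exists>h. h \<in> alg_iso (DO_algebra UNIV (W_tilde a)) model_algebra"
proof -
  \<comment> \<open>These values make the off-diagonal entries total derivatives: there
    \<open>a = - 2 b\<close> matches the term \<open>X f g\<close>, and \<open>s = 2 |b|^2\<close>
    cancels the term \<open>X^2 f g'\<close>, in agreement with \<open>first_order\<close> for
    \<tau> = 2.\<close>
  define b where "b = - a / 2"
  define s where "s = 2 * (norm b)\<^sup>2"
  have b: "b \<noteq> 0" and a: "a = - 2 * b"
    using assms by (simp_all add: b_def)
  have s: "complex_of_real s = 2 * (b * cnj b)"
    unfolding s_def of_real_mult complex_norm_square by simp
  let ?V = "mat2 [:1, 0, a * cnj a:] [:0, a:] [:0, cnj a:] [:1:]"
  interpret darboux_family 0 2 1 0 1 s b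
    using b by unfold_locales (simp_all add: s_def)
  interpret pearson_weight 0 2 UNIV "\<lambda>t. exp (- t\<^sup>2)"
    by (rule hermite_pearson_weight)
  interpret darboux_weight 0 2 1 0 1 s b UNIV "\<lambda>t. exp (- t\<^sup>2)" "W_tilde a" ?V
    "\<lambda>i. if i = 1 then 1 + s else 1" "\<lambda>i. (norm b)\<^sup>2"
  proof
    show "W_tilde a t $ i $ j = of_real (exp (- t\<^sup>2)) * poly (?V $ i $ j) (of_real t)" for t i j
      using exhaust_2[of i] exhaust_2[of j]
      by (auto simp: W_tilde_eq scaleR_conv_of_real[where 'a = complex] power2_eq_square algebra_simps)
    show "0 < (if i = 1 then 1 + s else 1)" "0 \<le> (norm b)\<^sup>2" for i :: 2
      by (simp_all add: s_def add_pos_nonneg)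
    show "\<exists>h. (hat f ** ?V ** hat g) $ i $ j = (if i = j then [:of_real (if i = 1 then 1 + s else 1):] * (sigma 0 * f * g)
        + [:of_real ((norm b)\<^sup>2):] * (sigma 0 * sigma 0 * pderiv f * pderiv g) else 0) + pearson 0 2 h" for f g i j
    proof -
      let ?B = "[:b:]" and ?C = "[:cnj b:]" and ?X = "[:0, 1:] :: complex poly"
      have hat: "hat h = mat2 h (?B * pderiv h) (?C * pderiv h) (h + 2 * ?B * ?C * ?X * pderiv h)" for h
        by (simp add: hat_def s numeral_poly mult_ac)
      have V: "?V = mat2 (1 + 4 * ?B * ?C * ?X * ?X) (- 2 * ?B * ?X) (- 2 * ?C * ?X) 1"
        by (simp add: a numeral_poly one_pCons mult_ac)
      have sigma: "sigma 0 = 1"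
        by (simp add: sigma_def)
      have pearson: "pearson 0 2 h = pderiv h - 2 * ?X * h" for h
        by (simp add: pearson_def sigma numeral_poly)
      have const: "pderiv ([:c:] * h) = [:c:] * pderiv h" for c :: complex and h
        by (simp add: pderiv_smult)
      have K: "[:complex_of_real (1 + s):] = 1 + 2 * ?B * ?C" "[:complex_of_real ((norm b)\<^sup>2):] = ?B * ?C"
        unfolding of_real_add s complex_norm_square by (simp_all add: numeral_poly one_pCons)
      have X: "pderiv (?X * h) = h + ?X * pderiv h" for h
        by (simp add: pderiv_mult pderiv_pCons)
      have c: "[:- 2 * (b * cnj b):] = - 2 * ?B * ?C"
        by (simp add: numeral_poly)
      have prod: "hat f ** ?V ** hat g = mat2
          ((1 + 2 * ?B * ?C) * (f * g) + ?B * ?C * (pderiv f * pderiv g) + pearson 0 2 ([:- 2 * (b * cnj b):] * (?X * (f * g))))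
          (pearson 0 2 (?B * (f * g))) (pearson 0 2 (?C * (f * g))) (f * g + ?B * ?C * (pderiv f * pderiv g))"
        unfolding hat V mat2_mult hermite_gram_identities pearson const X
        unfolding pderiv_mult c
        by (simp only: mult.commute add.commute)
      have "pearson 0 2 0 = 0"
        by (simp add: pearson)
      then show ?thesis
        using exhaust_2[of i] exhaust_2[of j] unfolding prod sigma mult_1 K
        by (auto simp: K(1)[unfolded of_real_add of_real_1] simp del: mult_pCons_left mult_pCons_right intro: exI[of _ 0])
    qed
  qed
  show ?thesis
    by (rule DO_algebra_iso_model)
qed

section \<open>The Gegenbauer weight\<close>

text \<open>The antiderivative is \<open>(1 - t^2)^(n/2)\<close> times \<open>h\<close>, which
  vanishes at both end points as \<open>n > 0\<close>. It may fail to be differentiable there, hence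
  the interior version of the fundamental theorem.\<close>

lemma gegenbauer_FTC:
  fixes h :: "complex poly"
  assumes "0 < n"
  shows "((\<lambda>t. of_real ((1 - t\<^sup>2) powr (n / 2 - 1)) * poly (pearson 1 n h) (of_real t)) has_integral 0) {-1<..<1::real}"
proof -
  define u where "u t = complex_of_real ((1 - t\<^sup>2) powr (n / 2)) * poly h (of_real t)" for t :: real
  have deriv: "(u has_vector_derivative of_real ((1 - t\<^sup>2) powr (n / 2 - 1)) * poly (pearson 1 n h) (of_real t)) (at t)"
    if "t \<in> {-1<..<1}" for t
  proof -
    have pos: "1 - t\<^sup>2 > 0"
      using that by (simp add: abs_square_less_1 abs_less_iff)
    have 1: "((\<lambda>t. (1 - t\<^sup>2) powr (n / 2)) has_real_derivative - n * t * (1 - t\<^sup>2) powr (n / 2 - 1)) (at t)"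
    proof -
      have "((\<lambda>t. 1 - t\<^sup>2) has_real_derivative - 2 * t) (at t)"
        by (auto intro!: derivative_eq_intros)
      from DERIV_fun_powr[OF this pos, of "n / 2"] show ?thesis
        by (simp add: mult_ac)
    qed
    have w: "(1 - t\<^sup>2) powr (n / 2) = (1 - t\<^sup>2) * (1 - t\<^sup>2) powr (n / 2 - 1)"
      using pos by (simp add: powr_diff)
    have "(poly h has_field_derivative poly (pderiv h) (of_real t)) (at (of_real t))"
      by (rule poly_DERIV)
    from has_vector_derivative_mult[OF has_vector_derivative_of_real[OF 1] has_vector_derivative_real_field[OF this]]
    have "(u has_vector_derivative of_real ((1 - t\<^sup>2) powr (n / 2)) * poly (pderiv h) (of_real t)
        + of_real (- n * t * (1 - t\<^sup>2) powr (n / 2 - 1)) * poly h (of_real t)) (at t)"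
      unfolding u_def .
    moreover have "of_real ((1 - t\<^sup>2) powr (n / 2)) * poly (pderiv h) (of_real t)
        + of_real (- n * t * (1 - t\<^sup>2) powr (n / 2 - 1)) * poly h (of_real t)
        = of_real ((1 - t\<^sup>2) powr (n / 2 - 1)) * poly (pearson 1 n h) (of_real t)"
      unfolding w by (simp add: pearson_def sigma_def algebra_simps power2_eq_square)
    ultimately show ?thesis
      by (simp only:)
  qed
  have "continuous_on {-1..1} u"
    unfolding u_def using assms
    by (intro continuous_intros continuous_on_powr' continuous_on_poly) (auto simp: abs_square_le_1 abs_le_iff)
  then have "((\<lambda>t. of_real ((1 - t\<^sup>2) powr (n / 2 - 1)) * poly (pearson 1 n h) (of_real t)) has_integral (u 1 - u (- 1))) {-1..1}"
    by (intro fundamental_theorem_of_calculus_interior deriv) auto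
  moreover have "u 1 = 0" "u (- 1) = 0"
    by (simp_all add: u_def)
  ultimately show ?thesis
    by (simp add: has_integral_Icc_iff_Ioo)
qed

text \<open>For \<open>n < 2\<close> the weight is unbounded near the end points. Taking
  \<open>h\<close> to be the variable in \<open>gegenbauer_FTC\<close> expresses it by an integrable
  derivative and the continuous function \<open>(1 - t^2)^(n/2)\<close>.\<close>

lemma gegenbauer_integrable:
  assumes "0 < n"
  shows "set_integrable lborel {-1<..<1} (\<lambda>t. (1 - t\<^sup>2) powr (n / 2 - 1) :: real)"
proof -
  let ?w = "\<lambda>t::real. (1 - t\<^sup>2) powr (n / 2 - 1)"
  have "((\<lambda>t. Re (of_real (?w t) * poly (pearson 1 n [:0, 1:]) (of_real t))) has_integral Re 0) {-1<..<1}"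
    by (rule has_integral_Re) (rule gegenbauer_FTC[OF assms])
  then have 1: "(\<lambda>t. Re (of_real (?w t) * poly (pearson 1 n [:0, 1:]) (of_real t))) integrable_on {-1<..<1}"
    by blast
  have "continuous_on {-1..1} (\<lambda>t::real. (1 - t\<^sup>2) powr (n / 2))"
    using assms by (intro continuous_intros continuous_on_powr') (auto simp: abs_square_le_1 abs_le_iff)
  then have "(\<lambda>t. (1 - t\<^sup>2) powr (n / 2)) integrable_on {-1..1::real}"
    by (rule integrable_continuous_interval)
  then have 2: "(\<lambda>t. (1 - t\<^sup>2) powr (n / 2)) integrable_on {-1<..<1::real}"
    by (simp add: integrable_on_Icc_iff_Ioo)
  have eq: "?w t = (1 + 1 / n) * (1 - t\<^sup>2) powr (n / 2) - (1 / n) * Re (of_real (?w t) * poly (pearson 1 n [:0, 1:]) (of_real t))"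
    if "t \<in> {-1<..<1}" for t
  proof -
    have pos: "1 - t\<^sup>2 > 0"
      using that by (simp add: abs_square_less_1 abs_less_iff)
    have w: "(1 - t\<^sup>2) powr (n / 2) = (1 - t\<^sup>2) * ?w t"
      using pos by (simp add: powr_diff)
    have "poly (pearson 1 n [:0, 1:]) (of_real t) = complex_of_real (1 - t\<^sup>2 - n * t\<^sup>2)"
      by (simp add: pearson_def sigma_def pderiv_pCons power2_eq_square algebra_simps)
    then have re: "Re (of_real (?w t) * poly (pearson 1 n [:0, 1:]) (of_real t)) = ?w t * (1 - t\<^sup>2 - n * t\<^sup>2)"
      by (simp only: of_real_mult[symmetric] Re_complex_of_real)
    have "v = (1 + 1 / n) * ((1 - t\<^sup>2) * v) - (1 / n) * (v * (1 - t\<^sup>2 - n * t\<^sup>2))" for v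
      using assms by (simp add: field_simps)
    then show ?thesis
      unfolding w re .
  qed
  have "?w integrable_on {-1<..<1}"
    by (rule integrable_eq[OF integrable_diff[OF integrable_on_mult_right[OF 2] integrable_on_mult_right[OF 1]]])
       (rule eq[symmetric])
  \<comment> \<open>Nonnegativity upgrades gauge integrability to Lebesgue integrability.\<close>
  then have "?w absolutely_integrable_on {-1<..<1}"
    by (rule nonnegative_absolutely_integrable_1) simp
  then show ?thesis
    unfolding set_integrable_def by (subst (asm) integrable_completion) auto
qed

lemma gegenbauer_pearson_weight:
  assumes "0 < n"
  shows "pearson_weight 1 n {-1<..<1} (\<lambda>t. (1 - t\<^sup>2) powr (n / 2 - 1))"
proof
  let ?w = "\<lambda>t::real. (1 - t\<^sup>2) powr (n / 2 - 1)"
  show int: "set_integrable lborel {-1<..<1} (\<lambda>t. complex_of_real (?w t) * poly f (of_real t))" for f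
  proof -
    have "continuous_on {-1..1} (\<lambda>t. poly f (complex_of_real t))"
      by (intro continuous_intros)
    then have "bounded ((\<lambda>t. poly f (complex_of_real t)) ` {-1..1})"
      by (intro compact_imp_bounded compact_continuous_image) auto
    then obtain C where "\<forall>z\<in>(\<lambda>t. poly f (complex_of_real t)) ` {-1..1}. norm z \<le> C"
      unfolding bounded_iff by blast
    then have C: "norm (poly f (complex_of_real t)) \<le> C" if "t \<in> {-1..1}" for t
      using that by blast
    have "integrable lborel (\<lambda>t. C * (indicator {-1<..<1} t *\<^sub>R ?w t))"
      using gegenbauer_integrable[OF assms] unfolding set_integrable_def by (rule integrable_mult_right)
    then show ?thesis
      unfolding set_integrable_def
    proof (rule Bochner_Integration.integrable_bound)
      have "(\<lambda>t. poly f (complex_of_real t)) \<in> borel_measurable borel"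
        by (intro borel_measurable_continuous_onI continuous_intros)
      then show "(\<lambda>t. indicator {-1<..<1} t *\<^sub>R (complex_of_real (?w t) * poly f (of_real t))) \<in> borel_measurable lborel"
        by measurable
      show "AE t in lborel. norm (indicator {-1<..<1} t *\<^sub>R (complex_of_real (?w t) * poly f (of_real t)))
          \<le> norm (C * (indicator {-1<..<1} t *\<^sub>R ?w t))"
      proof (rule AE_I2)
        fix t :: real
        have "norm (poly f (complex_of_real t)) \<le> \<bar>C\<bar>" if "t \<in> {-1<..<1}"
          using C[of t] that by auto
        then show "norm (indicator {-1<..<1} t *\<^sub>R (complex_of_real (?w t) * poly f (of_real t)))
            \<le> norm (C * (indicator {-1<..<1} t *\<^sub>R ?w t))"
          by (auto simp: indicator_def norm_mult abs_mult mult.commute intro!: mult_right_mono)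
      qed
    qed
  qed
  show "wint {-1<..<1} ?w (pearson 1 n h) = 0" for h
    unfolding wint_def using set_borel_integral_eq_integral(2)[OF int] gegenbauer_FTC[OF assms]
    by (simp add: integral_unique)
  have sq: "t\<^sup>2 < 1" if "t \<in> {-1<..<1}" for t :: real
    using that by (simp add: abs_square_less_1 abs_less_iff)
  show "0 < ?w t" "0 < 1 - 1 * t\<^sup>2" if "t \<in> {-1<..<1}" for t
    using sq[OF that] by simp_all
qed (use assms in simp_all)

text \<open>The counterpart of \<open>hermite_gram_identities\<close>, with \<open>P\<close> for
  \<open>p\<close> and \<open>Q\<close> for \<open>n - p\<close>; here the remainders have the shape
  \<open>(1 - X^2) h' - (P + Q) X h\<close>.\<close>

lemma gegenbauer_gram_identities:
  fixes f g f' g' X P Q :: "'a::comm_ring_1"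
  shows "((P * f + X * f') * (Q + P * X * X) + f' * (- (P + Q) * X)) * (P * g + X * g')
      + ((P * f + X * f') * (- (P + Q) * X) + f' * (P + Q * X * X)) * g'
      = P * P * (Q + 1) * ((1 - X * X) * (f * g)) + P * ((1 - X * X) * (1 - X * X) * (f' * g'))
        + ((1 - X * X) * (- P * P * (f * g + X * (f' * g + f * g'))) - (P + Q) * X * (- P * P * (X * (f * g))))"
    and "((P * f + X * f') * (Q + P * X * X) + f' * (- (P + Q) * X)) * g'
      + ((P * f + X * f') * (- (P + Q) * X) + f' * (P + Q * X * X)) * (Q * g + X * g')
      = (1 - X * X) * (P * Q * (f' * g + f * g')) - (P + Q) * X * (P * Q * (f * g))"
    and "(f' * (Q + P * X * X) + (Q * f + X * f') * (- (P + Q) * X)) * (P * g + X * g')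
      + (f' * (- (P + Q) * X) + (Q * f + X * f') * (P + Q * X * X)) * g'
      = (1 - X * X) * (P * Q * (f' * g + f * g')) - (P + Q) * X * (P * Q * (f * g))"
    and "(f' * (Q + P * X * X) + (Q * f + X * f') * (- (P + Q) * X)) * g'
      + (f' * (- (P + Q) * X) + (Q * f + X * f') * (P + Q * X * X)) * (Q * g + X * g')
      = Q * Q * (P + 1) * ((1 - X * X) * (f * g)) + Q * ((1 - X * X) * (1 - X * X) * (f' * g'))
        + ((1 - X * X) * (- Q * Q * (f * g + X * (f' * g + f * g'))) - (P + Q) * X * (- Q * Q * (X * (f * g))))"
  by (simp_all add: algebra_simps)

theorem DO_algebra_W_iso_model:
  assumes "0 < p" "p < n / 2"
  shows "\<exists>h. h \<in> alg_iso (DO_algebra {-1<..<1} (W p n)) model_algebra"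
proof -
  define p' where "p' = n - p"
  \<comment> \<open>The inequality \<open>p < n / 2\<close> enters as \<open>p \<noteq> p'\<close>,
    the condition \<open>gap\<close> without which the two eigenvalues would coincide.\<close>
  have p': "0 < p'" and n: "n = p + p'" "0 < n" and neq: "p \<noteq> p'"
    using assms by (simp_all add: p'_def)
  let ?V = "mat2 [:of_real p', 0, of_real p:] [:0, - of_real n:] [:0, - of_real n:] [:of_real p, 0, of_real p':] :: mpoly"
  let ?w = "\<lambda>t::real. (1 - t\<^sup>2) powr (n / 2 - 1)"
  interpret darboux_family 1 n p 1 p' 1 1
    using assms(1) p' n neq by unfold_locales simp_all
  interpret pearson_weight 1 n "{-1<..<1}" ?w
    by (rule gegenbauer_pearson_weight[OF n(2)])
  interpret darboux_weight 1 n p 1 p' 1 1 "{-1<..<1}" ?w "W p n" ?V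
    "\<lambda>i. if i = 1 then p\<^sup>2 * (p' + 1) else p'\<^sup>2 * (p + 1)" "\<lambda>i. if i = 1 then p else p'"
  proof
    show "W p n t $ i $ j = of_real (?w t) * poly (?V $ i $ j) (of_real t)" for t i j
      using exhaust_2[of i] exhaust_2[of j] unfolding W_def mat2_def[symmetric] p'_def
      by (auto simp: power2_eq_square algebra_simps)
    show "0 < (if i = 1 then p\<^sup>2 * (p' + 1) else p'\<^sup>2 * (p + 1))" "0 \<le> (if i = 1 then p else p')" for i :: 2
      using assms(1) p' by simp_all
    show "\<exists>h. (hat f ** ?V ** hat g) $ i $ j =
        (if i = j then [:of_real (if i = 1 then p\<^sup>2 * (p' + 1) else p'\<^sup>2 * (p + 1)):] * (sigma 1 * f * g)
          + [:of_real (if i = 1 then p else p'):] * (sigma 1 * sigma 1 * pderiv f * pderiv g) else 0)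
        + pearson 1 n h" for f g i j
    proof -
      let ?P = "[:complex_of_real p:]" and ?Q = "[:complex_of_real p':]" and ?X = "[:0, 1:] :: complex poly"
      have hat: "hat h = mat2 (?P * h + ?X * pderiv h) (pderiv h) (pderiv h) (?Q * h + ?X * pderiv h)" for h
        by (simp add: hat_def)
      have V: "?V = mat2 (?Q + ?P * ?X * ?X) (- (?P + ?Q) * ?X) (- (?P + ?Q) * ?X) (?P + ?Q * ?X * ?X)"
        by (simp add: n)
      have sigma: "sigma 1 = 1 - ?X * ?X"
        by (simp add: sigma_def one_pCons)
      have pearson: "pearson 1 n h = (1 - ?X * ?X) * pderiv h - (?P + ?Q) * ?X * h" for h
        unfolding pearson_def sigma by (simp add: n)
      have const: "pderiv ([:c:] * h) = [:c:] * pderiv h" for c :: complex and h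
        by (simp add: pderiv_smult)
      have X: "pderiv (?X * h) = h + ?X * pderiv h" for h
        by (simp add: pderiv_mult pderiv_pCons)
      have c: "[:- (complex_of_real p * of_real p):] = - ?P * ?P" "[:- (complex_of_real p' * of_real p'):] = - ?Q * ?Q"
        "[:complex_of_real p * of_real p':] = ?P * ?Q"
        by simp_all
      have K: "[:complex_of_real (p\<^sup>2 * (p' + 1)):] = ?P * ?P * (?Q + 1)"
        "[:complex_of_real (p'\<^sup>2 * (p + 1)):] = ?Q * ?Q * (?P + 1)"
        by (simp_all add: one_pCons power2_eq_square)
      let ?K = "\<lambda>c d. [:complex_of_real c:] * (sigma 1 * f * g) + [:complex_of_real d:] * (sigma 1 * sigma 1 * pderiv f * pderiv g)"
      have prod: "hat f ** ?V ** hat g = mat2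
          (?K (p\<^sup>2 * (p' + 1)) p + pearson 1 n ([:- (complex_of_real p * of_real p):] * (?X * (f * g))))
          (pearson 1 n ([:complex_of_real p * of_real p':] * (f * g)))
          (pearson 1 n ([:complex_of_real p * of_real p':] * (f * g)))
          (?K (p'\<^sup>2 * (p + 1)) p' + pearson 1 n ([:- (complex_of_real p' * of_real p'):] * (?X * (f * g))))"
        unfolding hat V mat2_mult gegenbauer_gram_identities pearson const X K
        unfolding pderiv_mult c sigma
        by (simp only: mult.commute mult.left_commute mult.assoc add.commute)
      show ?thesis
        using exhaust_2[of i] exhaust_2[of j] unfolding prod by auto
    qed
  qed
  show ?thesis
    by (rule DO_algebra_iso_model)
qed

theorem theorem5p5:
  fixes n p :: real and a :: complex
  assumes "0 < p" and "p < n / 2" and "a \<noteq> 0"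
  shows "\<exists>h. h \<in> alg_iso (DO_algebra {-1<..<1} (W p n)) (DO_algebra UNIV (W_tilde a))"
proof -
  obtain f g where f: "f \<in> alg_iso (DO_algebra {-1<..<1} (W p n)) model_algebra"
    and g: "g \<in> alg_iso (DO_algebra UNIV (W_tilde a)) model_algebra"
    using DO_algebra_W_iso_model DO_algebra_W_tilde_iso_model assms by blast
  \<comment> \<open>Both isomorphisms lead into the common model, so the second one is inverted
    before composing.\<close>
  have "inv_into (carrier (DO_algebra UNIV (W_tilde a))) g \<in> alg_iso model_algebra (DO_algebra UNIV (W_tilde a))"
    using ring_DO_algebra _ g by (rule alg_iso_sym) (simp add: DO_algebra_def DO_smult_closed)
  from alg_iso_trans[OF f this] show ?thesis
    by blast
qed

end
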